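(* Let $G=\mathrm{SL}_2(\mathbb Z)$, let $B_X=\{\gamma\in G:\|\gamma\|\le X\}$, and let $\mu_X$ be the normalized counting measure on $B_X^2$. For $g=(g_1,g_2)$ let $\Gamma(g)=\langle g_1,g_1^{-1},g_2,g_2^{-1}\rangle$. Then $$\lim_{X\to\infty}\mu_X\big(\{g=(g_1,g_2)\in G^2 : \Gamma(g)\text{ is thin}\}\big)=1.$$
   Context: For $\gamma\in\mathrm{SL}_2(\mathbb R)$, $\|\gamma\|^2=\lambda_{\max}(\gamma^t\gamma)$ (largest eigenvalue). A subgroup $\Gamma\le \mathrm{GL}_n(\mathbb Z)$ with Zariski closure $\overline{\Gamma}$ in $\mathrm{GL}_n(\mathbb C)$ is thin if it has infinite index in $\overline{\Gamma}\cap\mathrm{GL}_n(\mathbb Z)$. *)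

theory Defs
  imports "HOL-Analysis.Analysis"
begin

type_synonym imat = "int ^ 2 ^ 2"
type_synonym cmat = "complex ^ 2 ^ 2"

definition SL2Z :: "imat set" where
  "SL2Z = {A. det A = 1}"

definition GL2Z :: "imat set" where
  "GL2Z = {A. det A = 1 \<or> det A = -1}"

definition to_real :: "imat \<Rightarrow> real ^ 2 ^ 2" where
  "to_real A = (\<chi> i j. real_of_int (A $ i $ j))"

definition to_cplx :: "imat \<Rightarrow> cmat" where
  "to_cplx A = (\<chi> i j. complex_of_int (A $ i $ j))"

definition lambda_max :: "real ^ 2 ^ 2 \<Rightarrow> real" where
  "lambda_max M = Sup {l. \<exists>v::real^2. v \<noteq> 0 \<and> M *v v = l *\<^sub>R v}"

definition mnorm :: "imat \<Rightarrow> real" where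
  "mnorm g = sqrt (lambda_max (transpose (to_real g) ** to_real g))"

definition ball_X :: "real \<Rightarrow> imat set" where
  "ball_X X = {g \<in> SL2Z. mnorm g \<le> X}"

definition sl2_inv :: "imat \<Rightarrow> imat" where
  "sl2_inv A = (\<chi> i j. if i = 1 \<and> j = 1 then A $ 2 $ 2
                        else if i = 2 \<and> j = 2 then A $ 1 $ 1
                        else - A $ i $ j)"

inductive_set gen_group :: "imat set \<Rightarrow> imat set" for S where
  gen_one: "mat 1 \<in> gen_group S"
| gen_base: "s \<in> S \<Longrightarrow> s \<in> gen_group S"
| gen_mult: "a \<in> gen_group S \<Longrightarrow> b \<in> gen_group S \<Longrightarrow> a ** b \<in> gen_group S"
| gen_inv: "a \<in> gen_group S \<Longrightarrow> sl2_inv a \<in> gen_group S"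

definition Gamma :: "imat \<times> imat \<Rightarrow> imat set" where
  "Gamma g = gen_group {fst g, sl2_inv (fst g), snd g, sl2_inv (snd g)}"

(* polynomials in the four matrix entries, as finitely supported coefficient
   functions on exponent vectors (a,b,c,d) for x11^a x12^b x21^c x22^d *)
definition is_poly4 :: "(nat \<times> nat \<times> nat \<times> nat \<Rightarrow> complex) \<Rightarrow> bool" where
  "is_poly4 p \<longleftrightarrow> finite {e. p e \<noteq> 0}"

definition eval_poly4 :: "(nat \<times> nat \<times> nat \<times> nat \<Rightarrow> complex) \<Rightarrow> cmat \<Rightarrow> complex" where
  "eval_poly4 p M = (\<Sum>e\<in>{e. p e \<noteq> 0}. case e of (a, b, c, d) \<Rightarrow>
      p e * (M $ 1 $ 1) ^ a * (M $ 1 $ 2) ^ b * (M $ 2 $ 1) ^ c * (M $ 2 $ 2) ^ d)"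

(* Zariski closure in GL_2(C) of a set of complex matrices (GL_2(C) is open in M_2(C),
   so this is the closure in M_2(C) intersected with GL_2(C)) *)
definition zariski_closure_GL2 :: "cmat set \<Rightarrow> cmat set" where
  "zariski_closure_GL2 S = {M. det M \<noteq> 0 \<and>
     (\<forall>p. is_poly4 p \<longrightarrow> (\<forall>s\<in>S. eval_poly4 p s = 0) \<longrightarrow> eval_poly4 p M = 0)}"

definition thin :: "imat set \<Rightarrow> bool" where
  "thin \<Gamma> \<longleftrightarrow>
     (let H = {A \<in> GL2Z. to_cplx A \<in> zariski_closure_GL2 (to_cplx ` \<Gamma>)}
      in infinite {(\<lambda>x. h ** x) ` \<Gamma> | h. h \<in> H})"

definition mu_thin :: "real \<Rightarrow> real" where
  "mu_thin X = real (card {g \<in> ball_X X \<times> ball_X X. thin (Gamma g)})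
               / real (card (ball_X X \<times> ball_X X))"

end

theory Submission
  imports Defs
begin

text \<open>
  Let \<open>g\<close> have entries \<open>a b c d\<close>. As a Moebius map, \<open>g\<close> sends the complement of a neighbourhood of
  \<open>-d/c\<close> into a neighbourhood of \<open>a/c\<close>, because \<open>g z = a/c - 1 / (c\<^sup>2 (z + d/c))\<close>. If \<open>\<bar>tr g\<bar> \<ge> 3\<close>, all
  powers of \<open>g\<close> do this with almost the same centres, so the cyclic groups of \<open>g\<close> and \<open>h\<close> play
  ping-pong as soon as the lower left entries are large and the points \<open>a/c\<close>, \<open>-d/c\<close> of \<open>g\<close> are far from
  those of \<open>h\<close>; no separation is needed between \<open>a/c\<close> and \<open>-d/c\<close> of the same matrix. Infinity lies
  outside all neighbourhoods, so no nontrivial element of the group fixes it, and the integer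
  translations \<open>z \<mapsto> z + k\<close> lie in pairwise different cosets.

  The Zariski closure contains all translations with large \<open>k\<close>: it contains the torus \<open>D\<close> of the hyperbolic
  element \<open>g\<close>, and \<open>D h D h D\<close> contains every unimodular matrix which maps no fixed point of \<open>g\<close> to a
  fixed point of \<open>g\<close>.

  There are at least of the order of \<open>X\<^sup>2\<close> matrices in the ball (count coprime first columns). Those violating one of
  the conditions are few: a column determines the other one up to multiples of itself, which bounds the
  matrices with small \<open>c\<close> or with \<open>a/c\<close> near a given point; and for \<open>\<bar>tr g\<bar> \<le> 2\<close> the entry \<open>c\<close> is one of
  the \<open>o(X)\<close> large divisors of a number of size at most about \<open>X\<^sup>2\<close>, as three divisors close to each other
  have a large least common multiple.
\<close>

section \<open>Ping-pong\<close>

lemma mat2_eq_iff: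
  "(A::'a^2^2) = B \<longleftrightarrow> A$1$1 = B$1$1 \<and> A$1$2 = B$1$2 \<and> A$2$1 = B$2$1 \<and> A$2$2 = B$2$2"
  by (auto simp: vec_eq_iff forall_2)

lemma mult2_nth: "((A::'a::semiring_1^2^2) ** B)$i$j = A$i$1 * B$1$j + A$i$2 * B$2$j"
  by (simp add: matrix_matrix_mult_def sum_2)

lemma mat2_nth [simp]:
  "(mat k :: 'a::zero^2^2)$1$1 = k" "(mat k :: 'a^2^2)$1$2 = 0"
  "(mat k :: 'a^2^2)$2$1 = 0" "(mat k :: 'a^2^2)$2$2 = k"
  by (simp_all add: mat_def)

lemma sl2_inv_nth [simp]:
  "sl2_inv A $1$1 = A$2$2" "sl2_inv A $1$2 = - A$1$2"
  "sl2_inv A $2$1 = - A$2$1" "sl2_inv A $2$2 = A$1$1"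
  by (simp_all add: sl2_inv_def)

lemma sl2_inv_sl2_inv [simp]: "sl2_inv (sl2_inv A) = A"
  by (simp add: mat2_eq_iff)

lemma SL2Z_iff: "A \<in> SL2Z \<longleftrightarrow> A$1$1 * A$2$2 - A$1$2 * A$2$1 = 1"
  by (simp add: SL2Z_def det_2)

lemma sl2_inv_in_SL2Z [simp]: "sl2_inv A \<in> SL2Z \<longleftrightarrow> A \<in> SL2Z"
  by (simp add: SL2Z_iff algebra_simps)

lemma mult_in_SL2Z: "A \<in> SL2Z \<Longrightarrow> B \<in> SL2Z \<Longrightarrow> A ** B \<in> SL2Z"
  by (simp add: SL2Z_def det_mul)

lemma one_in_SL2Z: "mat 1 \<in> SL2Z"
  by (simp add: SL2Z_def)

lemma sl2_inv_right: "A \<in> SL2Z \<Longrightarrow> A ** sl2_inv A = mat 1"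
  by (simp add: SL2Z_iff mat2_eq_iff mult2_nth algebra_simps)

lemma sl2_inv_mult: "sl2_inv (A ** B) = sl2_inv B ** sl2_inv A"
  by (simp add: mat2_eq_iff mult2_nth algebra_simps)

lemma sl2_inv_one: "sl2_inv (mat 1) = mat 1"
  by (simp add: mat2_eq_iff)

section \<open>Powers of a matrix and the zones that attract them\<close>

primrec mpow :: "'a::semiring_1^2^2 \<Rightarrow> nat \<Rightarrow> 'a^2^2" where
  "mpow A 0 = mat 1"
| "mpow A (Suc n) = A ** mpow A n"

definition tr2 :: "imat \<Rightarrow> int" where "tr2 g = g$1$1 + g$2$2"

text \<open>For a nonzero lower left entry this is the image of infinity under the Moebius map of
  \<open>g\<close>; \<open>att (sl2_inv g)\<close> is then the pole of \<open>g\<close>.\<close>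

definition att :: "imat \<Rightarrow> real" where "att g = of_int (g$1$1) / of_int (g$2$1)"

definition zone :: "real \<Rightarrow> imat \<Rightarrow> real set" where
  "zone r g = {z. \<bar>z - att g\<bar> < r \<or> \<bar>z - att (sl2_inv g)\<bar> < r}"

lemma zone_sl2_inv [simp]: "zone r (sl2_inv g) = zone r g"
  by (auto simp: zone_def)

lemma tr2_sl2_inv [simp]: "tr2 (sl2_inv g) = tr2 g"
  by (simp add: tr2_def)

text \<open>By Cayley--Hamilton every power of \<open>g\<close> is \<open>x g - y\<close> for integers \<open>x\<close>, \<open>y\<close>; if \<open>\<bar>tr g\<bar> \<ge> 3\<close>
  then \<open>\<bar>y\<bar> < \<bar>x\<bar>\<close>, so all powers attract to and repel from almost the same points.\<close>

lemma mpow_Suc_linear: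
  assumes g: "g \<in> SL2Z" and tr: "\<bar>tr2 g\<bar> \<ge> 3"
  shows "\<exists>x y. \<bar>y\<bar> < \<bar>x\<bar> \<and> mpow g (Suc n) $1$1 = x * g$1$1 - y \<and> mpow g (Suc n) $1$2 = x * g$1$2 \<and>
    mpow g (Suc n) $2$1 = x * g$2$1 \<and> mpow g (Suc n) $2$2 = x * g$2$2 - y"
proof (induction n)
  case 0
  show ?case by (rule exI[of _ 1], rule exI[of _ 0]) (simp add: mult2_nth)
next
  case (Suc n)
  define M where "M = mpow g (Suc n)"
  obtain x y where xy: "\<bar>y\<bar> < \<bar>x\<bar>"
    and e: "M$1$1 = x * g$1$1 - y" "M$1$2 = x * g$1$2" "M$2$1 = x * g$2$1" "M$2$2 = x * g$2$2 - y"
    using Suc unfolding M_def by blast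
  \<comment> \<open>Since g^2 = (tr g) g - 1, multiplication by \<open>g\<close> turns the pair (x,
    y) into (x tr g - y, x); as |tr g| >= 3, the inequality |y| < |x| persists.\<close>
  have "\<bar>x * tr2 g\<bar> \<ge> \<bar>x\<bar> * 3"
    unfolding abs_mult using tr by (rule mult_left_mono) simp
  then have 1: "\<bar>x\<bar> < \<bar>x * tr2 g - y\<bar>" using xy by linarith
  have d: "g$1$2 * g$2$1 = g$1$1 * g$2$2 - 1" using g by (simp add: SL2Z_iff)
  have "mpow g (Suc (Suc n)) = g ** M" by (simp add: M_def)
  moreover have "(g ** M)$1$1 = (x * tr2 g - y) * g$1$1 - x"
  proof -
    have "(g ** M)$1$1 = g$1$1 * (x * g$1$1 - y) + x * (g$1$2 * g$2$1)"
      by (simp add: mult2_nth e)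
    then show ?thesis unfolding d tr2_def by (simp add: algebra_simps)
  qed
  moreover have "(g ** M)$2$2 = (x * tr2 g - y) * g$2$2 - x"
  proof -
    have "(g ** M)$2$2 = x * (g$1$2 * g$2$1) + g$2$2 * (x * g$2$2 - y)"
      by (simp add: mult2_nth e)
    then show ?thesis unfolding d tr2_def by (simp add: algebra_simps)
  qed
  moreover have "(g ** M)$1$2 = (x * tr2 g - y) * g$1$2" "(g ** M)$2$1 = (x * tr2 g - y) * g$2$1"
    by (simp_all add: mult2_nth e tr2_def algebra_simps)
  ultimately show ?case using 1 by metis
qed

definition cyc :: "imat \<Rightarrow> imat set" where
  "cyc g = range (mpow g) \<union> range (mpow (sl2_inv g))"

lemma cyc_cases:
  assumes "m \<in> cyc g"
  obtains "m = mat 1" | n where "m = mpow g (Suc n)" | n where "m = mpow (sl2_inv g) (Suc n)"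
proof -
  obtain n where n: "m = mpow g n \<or> m = mpow (sl2_inv g) n"
    using assms by (auto simp: cyc_def)
  show thesis
  proof (cases n)
    case 0
    then show thesis using n that(1) by auto
  next
    case (Suc k)
    then show thesis using n that(2,3) by blast
  qed
qed

lemma one_in_cyc: "mat 1 \<in> cyc g"
  unfolding cyc_def by (metis UnI1 mpow.simps(1) rangeI)

lemma cyc_sl2_inv [simp]: "cyc (sl2_inv g) = cyc g"
  by (auto simp: cyc_def)

lemma cyc_mult:
  assumes g: "g \<in> SL2Z" and m: "m \<in> cyc g"
  shows "g ** m \<in> cyc g"
proof -
  consider n where "m = mpow g n" | n where "m = mpow (sl2_inv g) (Suc n)"
    using m by (elim cyc_cases) (metis mpow.simps)+
  then show ?thesis
  proof cases
    case 1
    then have "g ** m = mpow g (Suc n)" by simp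
    then show ?thesis unfolding cyc_def by blast
  next
    case 2
    then have "g ** m = mpow (sl2_inv g) n" by (simp add: matrix_mul_assoc sl2_inv_right[OF g])
    then show ?thesis unfolding cyc_def by blast
  qed
qed

text \<open>The matrix x g - y of determinant 1 acts on z = p/q, with q = 0 standing for infinity,
  by z -> (xa - y)/(xc) - 1/((xc)^2 w), where w = z + (xd - y)/(xc). Replacing the centre (xa -
  y)/(xc) by a/c costs less than 1/|c|, and the last term is at most 1/|c|; each of these bounds is
  at most r/2.\<close>

lemma moebius_contracts:
  fixes a b c d x y p q r :: real
  assumes det: "(x * a - y) * (x * d - y) - (x * b) * (x * c) = 1"
    and xy: "\<bar>y\<bar> < \<bar>x\<bar>" and x1: "\<bar>x\<bar> \<ge> 1" and r: "r > 0" and c: "\<bar>c\<bar> * r \<ge> 2"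
    and pq: "q = 0 \<and> p \<noteq> 0 \<or> q \<noteq> 0 \<and> \<bar>p / q + d / c\<bar> \<ge> r"
    and p': "p' = (x * a - y) * p + x * b * q" and q': "q' = x * c * p + (x * d - y) * q"
  shows "q' \<noteq> 0 \<and> \<bar>p' / q' - a / c\<bar> < r"
proof -
  have c0: "c \<noteq> 0" "\<bar>c\<bar> > 0" using c by auto
  have x0: "x \<noteq> 0" "\<bar>x\<bar> > 0" using x1 by auto
  have rc: "r / 2 \<ge> 1 / \<bar>c\<bar>" using c c0 by (simp add: field_simps)
  have yx: "\<bar>y / (x * c)\<bar> < 1 / \<bar>c\<bar>"
    using xy x0 c0 by (simp add: abs_mult field_simps)
  have am: "\<bar>(x * a - y) / (x * c) - a / c\<bar> < 1 / \<bar>c\<bar>"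
  proof -
    have "(x * a - y) / (x * c) - a / c = - (y / (x * c))" using x0 c0 by (simp add: field_simps)
    then show ?thesis using yx by simp
  qed
  show ?thesis
  proof (cases "q = 0")
    case True
    then have "p \<noteq> 0" using pq by simp
    have "p' / q' = (x * a - y) / (x * c)" "q' \<noteq> 0"
      using True \<open>p \<noteq> 0\<close> x0 c0 by (simp_all add: p' q')
    then show ?thesis using am rc r by auto
  next
    case False
    \<comment> \<open>\<open>w\<close> is the offset from the pole of x g - y. That pole is within
      1/|c| <= r/2 of -d/c, so |w| stays above r/2.\<close>
    define w where "w = p / q + (x * d - y) / (x * c)"
    have "w = (p / q + d / c) - y / (x * c)" using x0 c0 by (simp add: w_def field_simps)
    then have "\<bar>p / q + d / c\<bar> - \<bar>y / (x * c)\<bar> \<le> \<bar>w\<bar>" by (simp only: abs_triangle_ineq2)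
    moreover have "\<bar>p / q + d / c\<bar> \<ge> r" using pq False by blast
    ultimately have w: "\<bar>w\<bar> > r / 2" using yx rc by linarith
    then have w0: "w \<noteq> 0" using r by auto
    have q'w: "q' = x * c * q * w" using x0 c0 False by (simp add: q' w_def field_simps)
    then have q0: "q' \<noteq> 0" using x0 c0 False w0 by simp
    have "p' * (x * c) - (x * a - y) * q' = - q * ((x * a - y) * (x * d - y) - (x * b) * (x * c))"
      by (simp add: p' q' algebra_simps)
    then have k: "p' * (x * c) - (x * a - y) * q' = - q" using det by simp
    have "p' / q' - (x * a - y) / (x * c) = (p' * (x * c) - (x * a - y) * q') / (q' * (x * c))"
      using q0 x0 c0 by (simp add: field_simps)
    also have "\<dots> = - q / (q' * (x * c))" unfolding k ..
    also have "\<dots> = - 1 / ((x * c)\<^sup>2 * w)"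
      using False q0 x0 c0 w0 unfolding q'w by (simp add: field_simps power2_eq_square)
    finally have "\<bar>p' / q' - (x * a - y) / (x * c)\<bar> = 1 / (x\<^sup>2 * c\<^sup>2 * \<bar>w\<bar>)"
      by (simp add: abs_mult power_mult_distrib)
    also have "\<dots> \<le> 1 / (1 * c\<^sup>2 * (r / 2))"
    proof (rule divide_left_mono)
      have "1 \<le> x\<^sup>2" using x1 by (metis abs_le_square_iff abs_one one_power2)
      then show "1 * c\<^sup>2 * (r / 2) \<le> x\<^sup>2 * c\<^sup>2 * \<bar>w\<bar>"
        using w r by (intro mult_mono) auto
      show "0 < x\<^sup>2 * c\<^sup>2 * \<bar>w\<bar> * (1 * c\<^sup>2 * (r / 2))" using x0 c0 w0 r by simp
    qed simp
    also have "\<dots> = (1 / \<bar>c\<bar>) * (2 / (\<bar>c\<bar> * r))"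
      using c0 by (simp add: power2_eq_square field_simps abs_mult_self_eq)
    also have "\<dots> \<le> (1 / \<bar>c\<bar>) * 1"
      using c c0 by (intro mult_left_mono) (auto simp: field_simps)
    finally have "\<bar>p' / q' - (x * a - y) / (x * c)\<bar> \<le> 1 / \<bar>c\<bar>" by simp
    moreover have "\<bar>p' / q' - a / c\<bar> \<le>
        \<bar>p' / q' - (x * a - y) / (x * c)\<bar> + \<bar>(x * a - y) / (x * c) - a / c\<bar>"
      using abs_triangle_ineq[of "p' / q' - (x * a - y) / (x * c)" "(x * a - y) / (x * c) - a / c"]
      by (simp only: diff_add_cancel add_diff_eq)
    ultimately have "\<bar>p' / q' - a / c\<bar> < r" using am rc by linarith
    then show ?thesis using q0 by simp
  qed
qed

lemma mpow_in_SL2Z: "g \<in> SL2Z \<Longrightarrow> mpow g n \<in> SL2Z"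
  by (induction n) (auto simp: one_in_SL2Z mult_in_SL2Z)

lemma mpow_maps_into_zone:
  assumes g: "g \<in> SL2Z" and tr: "\<bar>tr2 g\<bar> \<ge> 3" and r: "r > 0"
    and c: "\<bar>real_of_int (g$2$1)\<bar> * r \<ge> 2"
    and m: "m = mpow g (Suc n)"
    and pq: "q = 0 \<and> p \<noteq> 0 \<or> q \<noteq> 0 \<and> p / q \<notin> zone r g"
    and p': "p' = of_int (m$1$1) * p + of_int (m$1$2) * q"
    and q': "q' = of_int (m$2$1) * p + of_int (m$2$2) * q"
  shows "q' \<noteq> 0 \<and> p' / q' \<in> zone r g"
proof -
  obtain x y where xy: "\<bar>y\<bar> < \<bar>x\<bar>"
    and e: "m$1$1 = x * g$1$1 - y" "m$1$2 = x * g$1$2" "m$2$1 = x * g$2$1" "m$2$2 = x * g$2$2 - y"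
    using mpow_Suc_linear[OF g tr, of n] unfolding m by blast
  have "m \<in> SL2Z" unfolding m by (rule mpow_in_SL2Z[OF g])
  then have "(x * g$1$1 - y) * (x * g$2$2 - y) - (x * g$1$2) * (x * g$2$1) = 1"
    by (simp only: SL2Z_iff e)
  then have det: "(real_of_int x * g$1$1 - y) * (real_of_int x * g$2$2 - y)
      - (real_of_int x * g$1$2) * (real_of_int x * g$2$1) = 1"
    by (simp only: of_int_mult[symmetric] of_int_diff[symmetric] of_int_eq_1_iff)
  have "q' \<noteq> 0 \<and> \<bar>p' / q' - of_int (g$1$1) / of_int (g$2$1)\<bar> < r"
  proof (rule moebius_contracts[OF det _ _ r c])
    show "\<bar>real_of_int y\<bar> < \<bar>real_of_int x\<bar>" using xy by linarith
    show "1 \<le> \<bar>real_of_int x\<bar>" using xy by linarith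
    show "q = 0 \<and> p \<noteq> 0 \<or> q \<noteq> 0 \<and> r \<le> \<bar>p / q + of_int (g$2$2) / of_int (g$2$1)\<bar>"
      using pq by (auto simp: zone_def att_def)
  qed (simp_all add: p' q' e)
  then show ?thesis by (simp add: zone_def att_def)
qed

text \<open>Negative powers are positive powers of the inverse, which has the same trace, zone and
  |c|.\<close>

lemma cyc_maps_into_zone:
  assumes g: "g \<in> SL2Z" and tr: "\<bar>tr2 g\<bar> \<ge> 3" and r: "r > 0"
    and c: "\<bar>real_of_int (g$2$1)\<bar> * r \<ge> 2"
    and m: "m \<in> cyc g" "m \<noteq> mat 1"
    and pq: "q = 0 \<and> p \<noteq> 0 \<or> q \<noteq> 0 \<and> p / q \<notin> zone r g"
    and p': "p' = of_int (m$1$1) * p + of_int (m$1$2) * q"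
    and q': "q' = of_int (m$2$1) * p + of_int (m$2$2) * q"
  shows "q' \<noteq> 0 \<and> p' / q' \<in> zone r g"
proof -
  consider n where "m = mpow g (Suc n)" | n where "m = mpow (sl2_inv g) (Suc n)"
    using m by (elim cyc_cases) auto
  then show ?thesis
  proof cases
    case 1
    show ?thesis by (rule mpow_maps_into_zone[OF g tr r c 1 pq p' q'])
  next
    case 2
    have "q' \<noteq> 0 \<and> p' / q' \<in> zone r (sl2_inv g)"
      by (rule mpow_maps_into_zone[OF _ _ r _ 2 _ p' q']) (use g tr c pq in simp_all)
    then show ?thesis by simp
  qed
qed

section \<open>Alternating words in two cyclic groups\<close>

definition good_pair :: "real \<Rightarrow> imat \<Rightarrow> imat \<Rightarrow> bool" where
  "good_pair r g h \<longleftrightarrow> r > 0 \<and> g \<in> SL2Z \<and> h \<in> SL2Z \<and> \<bar>tr2 g\<bar> \<ge> 3 \<and> \<bar>tr2 h\<bar> \<ge> 3 \<and>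
     \<bar>real_of_int (g$2$1)\<bar> * r \<ge> 2 \<and> \<bar>real_of_int (h$2$1)\<bar> * r \<ge> 2 \<and> zone r g \<inter> zone r h = {}"

lemma good_pair_commute: "good_pair r g h \<Longrightarrow> good_pair r h g"
  by (auto simp: good_pair_def)


text \<open>The first argument tells which cyclic group the leftmost syllable comes from, hence into
  which zone the word sends infinity.\<close>

inductive alt_word :: "imat \<Rightarrow> imat \<Rightarrow> imat \<Rightarrow> bool" where
  single: "m \<in> cyc g \<Longrightarrow> m \<noteq> mat 1 \<Longrightarrow> alt_word g h m"
| step: "m \<in> cyc g \<Longrightarrow> m \<noteq> mat 1 \<Longrightarrow> alt_word h g w \<Longrightarrow> alt_word g h (m ** w)"

text \<open>Infinity lies outside both zones, so the rightmost syllable moves it into its own zone;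
  each further syllable finds the point in the other zone, disjoint from its own. The quotient of
  the first column is the image of infinity.\<close>

lemma alt_word_infinity:
  assumes "alt_word g h w" "good_pair r g h"
  shows "w$2$1 \<noteq> 0 \<and> real_of_int (w$1$1) / real_of_int (w$2$1) \<in> zone r g"
  using assms
proof (induction rule: alt_word.induct)
  case (single m g h)
  have "real_of_int (m$2$1) \<noteq> 0 \<and> real_of_int (m$1$1) / real_of_int (m$2$1) \<in> zone r g"
    by (rule cyc_maps_into_zone[of g r m 0 1]) (use single in \<open>auto simp: good_pair_def\<close>)
  then show ?case by simp
next
  case (step m g h w)
  then have gp: "good_pair r h g" by (blast intro: good_pair_commute)
  then have w: "w$2$1 \<noteq> 0" "real_of_int (w$1$1) / real_of_int (w$2$1) \<in> zone r h"
    using step by blast+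
  then have "real_of_int (w$1$1) / real_of_int (w$2$1) \<notin> zone r g"
    using gp by (auto simp: good_pair_def)
  then have "real_of_int ((m ** w)$2$1) \<noteq> 0 \<and>
      real_of_int ((m ** w)$1$1) / real_of_int ((m ** w)$2$1) \<in> zone r g"
    by (intro cyc_maps_into_zone[of g r m "w$2$1" "w$1$1"])
      (use step w in \<open>auto simp: good_pair_def mult2_nth\<close>)
  then show ?case by simp
qed

definition alt_words :: "imat \<Rightarrow> imat \<Rightarrow> imat set" where
  "alt_words g h = {w. w = mat 1 \<or> alt_word g h w \<or> alt_word h g w}"

lemma alt_words_commute: "alt_words g h = alt_words h g"
  by (auto simp: alt_words_def)

lemma alt_word_sl2_inv: "alt_word g h w \<Longrightarrow> alt_word (sl2_inv g) h w \<and> alt_word g (sl2_inv h) w"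
  by (induction rule: alt_word.induct) (auto intro: alt_word.intros)

lemma alt_words_sl2_inv: "alt_words (sl2_inv g) h = alt_words g h"
  using alt_word_sl2_inv sl2_inv_sl2_inv unfolding alt_words_def by metis

text \<open>The factor \<open>g\<close> merges with a leading syllable from \<open>cyc g\<close>; if
  the two cancel, the rest is empty or starts with a syllable from \<open>cyc h\<close>.\<close>

lemma alt_words_mult_left:
  assumes g: "g \<in> SL2Z" and g1: "g \<noteq> mat 1" and w: "w \<in> alt_words g h"
  shows "g ** w \<in> alt_words g h"
proof -
  have gc: "g \<in> cyc g" using cyc_mult[OF g one_in_cyc] by simp
  consider "w = mat 1" | "alt_word h g w" | "alt_word g h w" using w by (auto simp: alt_words_def)
  then show ?thesis
  proof cases
    case 1
    then show ?thesis using gc g1 by (auto simp: alt_words_def intro: alt_word.intros)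
  next
    case 2
    then show ?thesis using gc g1 by (auto simp: alt_words_def intro: alt_word.intros)
  next
    case 3
    then show ?thesis
    proof cases
      case single
      then show ?thesis using cyc_mult[OF g]
        by (cases "g ** w = mat 1") (auto simp: alt_words_def intro: alt_word.intros)
    next
      case (step m w')
      then have "g ** m \<in> cyc g" using cyc_mult[OF g] by blast
      moreover have "g ** w = (g ** m) ** w'" using step by (simp add: matrix_mul_assoc)
      ultimately show ?thesis using step
        by (cases "g ** m = mat 1") (auto simp: alt_words_def intro: alt_word.intros)
    qed
  qed
qed

lemma Gamma_subset_alt_words:
  assumes gp: "good_pair r g h"
  shows "Gamma (g, h) \<subseteq> alt_words g h"
proof -
  have S: "g \<in> SL2Z" "h \<in> SL2Z" using gp by (auto simp: good_pair_def)
  have ne: "g \<noteq> mat 1" "h \<noteq> mat 1" "sl2_inv g \<noteq> mat 1" "sl2_inv h \<noteq> mat 1"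
    using gp by (auto simp: good_pair_def tr2_def mat2_eq_iff)
  have l: "g ** w \<in> alt_words g h" "sl2_inv g ** w \<in> alt_words g h"
    "h ** w \<in> alt_words g h" "sl2_inv h ** w \<in> alt_words g h" if w: "w \<in> alt_words g h" for w
  proof -
    show "g ** w \<in> alt_words g h" using alt_words_mult_left S ne w by blast
    show "sl2_inv g ** w \<in> alt_words g h"
      using alt_words_mult_left[of "sl2_inv g" w h] S ne w by (simp add: alt_words_sl2_inv)
    show "h ** w \<in> alt_words g h"
      using alt_words_mult_left[of h w g] S ne w by (simp add: alt_words_commute)
    show "sl2_inv h ** w \<in> alt_words g h"
      using alt_words_mult_left[of "sl2_inv h" w g] S ne w
      by (simp add: alt_words_sl2_inv alt_words_commute[of g])
  qed
  \<comment> \<open>Being stabilized under left multiplication by \<open>a\<close> and by its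
    inverse is a property that survives products and inverses; applied to the identity it gives
    membership of \<open>a\<close> itself.\<close>
  have "\<forall>w \<in> alt_words g h. a ** w \<in> alt_words g h \<and> sl2_inv a ** w \<in> alt_words g h"
    if "a \<in> Gamma (g, h)" for a
    using that unfolding Gamma_def
  proof (induction rule: gen_group.induct)
    case gen_one
    then show ?case by (simp add: sl2_inv_one)
  next
    case (gen_base s)
    then show ?case using l by auto
  next
    case (gen_mult a b)
    then show ?case by (simp add: sl2_inv_mult matrix_mul_assoc[symmetric])
  next
    case (gen_inv a)
    then show ?case by simp
  qed
  moreover have "mat 1 \<in> alt_words g h" by (simp add: alt_words_def)
  ultimately show ?thesis by force
qed

text \<open>A vanishing lower left entry means that infinity is fixed, while every nonempty
  alternating word moves it to a finite point.\<close>

lemma Gamma_fixing_infinity: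
  assumes gp: "good_pair r g h" and a: "a \<in> Gamma (g, h)" "a$2$1 = 0"
  shows "a = mat 1"
  using Gamma_subset_alt_words[OF gp] a alt_word_infinity[of g h a r] alt_word_infinity[of h g a r]
    gp good_pair_commute[OF gp]
  by (auto simp: alt_words_def)

section \<open>Zariski closure\<close>

text \<open>Agreement with a Laurent polynomial away from 0; the value at 0 is left free because
  \<open>1 / t\<close> defaults to 0 there.\<close>

definition laurent :: "(complex \<Rightarrow> complex) \<Rightarrow> bool" where
  "laurent f \<longleftrightarrow> (\<exists>q N. \<forall>t. t \<noteq> 0 \<longrightarrow> f t * t ^ N = poly q t)"

lemma laurent_const: "laurent (\<lambda>t. k)"
  unfolding laurent_def by (rule exI[of _ "[:k:]"], rule exI[of _ 0]) simp

lemma laurent_ident: "laurent (\<lambda>t. t)"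
  unfolding laurent_def by (rule exI[of _ "[:0, 1:]"], rule exI[of _ 0]) simp

lemma laurent_inverse: "laurent (\<lambda>t. 1 / t)"
  unfolding laurent_def by (rule exI[of _ "[:1:]"], rule exI[of _ 1]) simp

lemma laurent_mult:
  assumes "laurent f" "laurent g" shows "laurent (\<lambda>t. f t * g t)"
proof -
  obtain q N q' N' where *: "\<And>t. t \<noteq> 0 \<Longrightarrow> f t * t ^ N = poly q t" "\<And>t. t \<noteq> 0 \<Longrightarrow> g t * t ^ N' = poly q' t"
    using assms unfolding laurent_def by metis
  have "f t * g t * t ^ (N + N') = poly (q * q') t" if "t \<noteq> 0" for t
    using *[OF that, symmetric] by (simp add: power_add algebra_simps)
  then show ?thesis unfolding laurent_def by blast
qed

lemma laurent_add:
  assumes "laurent f" "laurent g" shows "laurent (\<lambda>t. f t + g t)"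
proof -
  obtain q N q' N' where *: "\<And>t. t \<noteq> 0 \<Longrightarrow> f t * t ^ N = poly q t" "\<And>t. t \<noteq> 0 \<Longrightarrow> g t * t ^ N' = poly q' t"
    using assms unfolding laurent_def by metis
  have "(f t + g t) * t ^ (N + N') = poly (q * monom 1 N' + q' * monom 1 N) t" if "t \<noteq> 0" for t
    using *[OF that, symmetric] by (simp add: power_add poly_monom algebra_simps)
  then show ?thesis unfolding laurent_def by blast
qed

lemma laurent_power: "laurent f \<Longrightarrow> laurent (\<lambda>t. f t ^ n)"
  by (induction n) (auto intro: laurent_const laurent_mult)

lemma laurent_sum: "(\<And>i. i \<in> I \<Longrightarrow> laurent (f i)) \<Longrightarrow> laurent (\<lambda>t. \<Sum>i\<in>I. f i t)"
  by (induction I rule: infinite_finite_induct) (auto intro: laurent_const laurent_add)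

lemma laurent_eq_0:
  assumes f: "laurent f" and S: "infinite S" "\<And>s. s \<in> S \<Longrightarrow> s \<noteq> 0 \<and> f s = 0" and t: "t \<noteq> 0"
  shows "f t = 0"
proof -
  obtain q N where q: "\<And>t. t \<noteq> 0 \<Longrightarrow> f t * t ^ N = poly q t"
    using f unfolding laurent_def by metis
  have "S \<subseteq> {s. poly q s = 0}" using S(2) q by force
  then have "q = 0" using S(1) poly_roots_finite finite_subset by blast
  then show ?thesis using q[OF t] t by simp
qed

definition laurent_mat :: "(complex \<Rightarrow> cmat) \<Rightarrow> bool" where
  "laurent_mat F \<longleftrightarrow> (\<forall>i j. laurent (\<lambda>t. F t $ i $ j))"

lemma laurent_mat_const: "laurent_mat (\<lambda>t. A)"
  by (simp add: laurent_mat_def laurent_const)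

lemma laurent_mat_mult: "laurent_mat F \<Longrightarrow> laurent_mat G \<Longrightarrow> laurent_mat (\<lambda>t. F t ** G t)"
  by (auto simp: laurent_mat_def mult2_nth intro!: laurent_add laurent_mult)

lemma laurent_eval_poly4: "laurent_mat F \<Longrightarrow> laurent (\<lambda>t. eval_poly4 p (F t))"
  unfolding eval_poly4_def laurent_mat_def
  by (intro laurent_sum) (auto simp: split_def intro!: laurent_mult laurent_power laurent_const)

section \<open>The diagonal torus and the Zariski closure\<close>

definition dg :: "complex \<Rightarrow> cmat" where
  "dg t = (\<chi> i j. if i = j then if i = 1 then t else 1 / t else 0)"

lemma dg_nth [simp]: "dg t $1$1 = t" "dg t $1$2 = 0" "dg t $2$1 = 0" "dg t $2$2 = 1 / t"
  by (simp_all add: dg_def)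

lemma laurent_mat_dg: "laurent_mat dg"
  by (simp add: laurent_mat_def forall_2 laurent_const laurent_ident laurent_inverse)

lemma mpow_conj_dg:
  assumes Q: "Q ** P = mat 1" and P: "P ** Q = mat 1" and G: "G = P ** dg l ** Q"
  shows "mpow G n = P ** dg (l ^ n) ** Q"
proof (induction n)
  case 0
  have "dg 1 = mat 1" by (simp add: mat2_eq_iff)
  then show ?case using P by simp
next
  case (Suc n)
  have "mpow G (Suc n) = P ** (dg l ** ((Q ** P) ** (dg (l ^ n) ** Q)))"
    by (simp only: mpow.simps Suc) (simp add: G matrix_mul_assoc)
  also have "\<dots> = P ** (dg l ** dg (l ^ n)) ** Q" by (simp add: Q matrix_mul_assoc)
  also have "dg l ** dg (l ^ n) = dg (l ^ Suc n)" by (simp add: mat2_eq_iff mult2_nth)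
  finally show ?case .
qed

text \<open>Along the torus, \<open>p\<close> becomes a Laurent polynomial in t vanishing at all
  powers l^n, which are pairwise distinct because |l| is neither 0 nor 1. The outer factors
  \<open>A\<close> and \<open>B\<close> make it possible to replace one power of \<open>G\<close> at
  a time inside a longer word.\<close>

lemma torus_in_closure:
  assumes Q: "Q ** P = mat 1" and P: "P ** Q = mat 1" and G: "G = P ** dg l ** Q"
    and l: "l \<noteq> 0" "norm l \<noteq> 1" and z: "\<And>n. eval_poly4 p (A ** mpow G n ** B) = 0" and t: "t \<noteq> 0"
  shows "eval_poly4 p (A ** (P ** dg t ** Q) ** B) = 0"
proof (rule laurent_eq_0[where S = "range (\<lambda>n::nat. l ^ n)" and
      f = "\<lambda>t. eval_poly4 p (A ** (P ** dg t ** Q) ** B)"])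
  show "laurent (\<lambda>t. eval_poly4 p (A ** (P ** dg t ** Q) ** B))"
    by (intro laurent_eval_poly4 laurent_mat_mult laurent_mat_const laurent_mat_dg)
  have "inj (\<lambda>n::nat. l ^ n)"
  proof (rule injI)
    fix m n :: nat assume "l ^ m = l ^ n"
    then have e: "norm l ^ m = norm l ^ n" by (metis norm_power)
    show "m = n"
    proof (cases "norm l > 1")
      case True
      then show ?thesis using e power_inject_exp by blast
    next
      case False
      then have "norm l < 1" "norm l > 0" using l by auto
      then show ?thesis using e power_strict_decreasing_iff[of "norm l"] by (metis linorder_neqE_nat less_irrefl)
    qed
  qed
  then show "infinite (range (\<lambda>n::nat. l ^ n))" by (rule range_inj_infinite)
  show "s \<noteq> 0 \<and> eval_poly4 p (A ** (P ** dg s ** Q) ** B) = 0" if "s \<in> range (\<lambda>n::nat. l ^ n)" for s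
    using that z l by (auto simp: mpow_conj_dg[OF Q P G, symmetric])
qed (rule t)

text \<open>Diagonal factors on both sides rescale the entries but preserve the product of the two
  diagonal entries, and for unimodular matrices without zero entries this product is the only
  invariant. So t is chosen to give \<open>h ** dg t ** h\<close> the diagonal product of
  \<open>m\<close>, and s, s' then adjust the scaling.\<close>

lemma dg_factorization:
  fixes h m :: cmat
  assumes dh: "det h = 1" and h: "\<And>i j. h$i$j \<noteq> 0" and dm: "det m = 1" and m: "\<And>i j. m$i$j \<noteq> 0"
  shows "\<exists>s t s'. s \<noteq> 0 \<and> t \<noteq> 0 \<and> s' \<noteq> 0 \<and> m = dg s ** h ** dg t ** h ** dg s'"
proof -
  define a b c d where abcd: "a = h$1$1" "b = h$1$2" "c = h$2$1" "d = h$2$2"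
  define x y z w where xyzw: "x = m$1$1" "y = m$1$2" "z = m$2$1" "w = m$2$2"
  have nz: "a \<noteq> 0" "b \<noteq> 0" "c \<noteq> 0" "d \<noteq> 0" "x \<noteq> 0" "y \<noteq> 0" "z \<noteq> 0" "w \<noteq> 0"
    using h m by (simp_all add: abcd xyzw)
  have D: "a * d - b * c = 1" "x * w - y * z = 1"
    using dh dm by (simp_all add: det_2 abcd xyzw)
  \<comment> \<open>With u = t^2, equality of the diagonal products becomes A u^2 + B u + C = 0; as
    A and C are nonzero, there is a nonzero root.\<close>
  define A B C where ABC: "A = a\<^sup>2 * b * c" "B = a\<^sup>2 * d\<^sup>2 + b\<^sup>2 * c\<^sup>2 - x * w" "C = b * c * d\<^sup>2"
  have A0: "A \<noteq> 0" and C0: "C \<noteq> 0" using nz by (simp_all add: ABC)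
  define e where "e = csqrt (B\<^sup>2 - 4 * A * C)"
  define u where "u = (- B + e) / (2 * A)"
  have "e\<^sup>2 = B\<^sup>2 - 4 * A * C" by (simp add: e_def)
  have u: "A * u\<^sup>2 + B * u + C = 0"
  proof -
    have "2 * A * u = - B + e" using A0 by (simp add: u_def)
    moreover have "4 * A * (A * u\<^sup>2 + B * u + C) = (2 * A * u)\<^sup>2 + 2 * B * (2 * A * u) + 4 * A * C"
      by (simp add: algebra_simps power2_eq_square)
    ultimately have "4 * A * (A * u\<^sup>2 + B * u + C) = (- B + e)\<^sup>2 + 2 * B * (- B + e) + 4 * A * C"
      by simp
    also have "\<dots> = 0" using \<open>e\<^sup>2 = _\<close> by (simp add: algebra_simps power2_eq_square)
    finally show ?thesis using A0 by simp
  qed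
  have u0: "u \<noteq> 0" using u C0 by auto
  define t where "t = csqrt u"
  have t2: "t\<^sup>2 = u" by (simp add: t_def)
  then have t0: "t \<noteq> 0" using u0 by auto
  define x' y' z' w' where d': "x' = a * t * a + b / t * c" "y' = a * t * b + b / t * d"
    "z' = c * t * a + d / t * c" "w' = c * t * b + d / t * d"
  have "u * (x' * w') = u * (x * w)"
  proof -
    have "u * (x' * w') = (t * x') * (t * w')" by (simp add: t2[symmetric] power2_eq_square)
    also have "t * x' = a\<^sup>2 * u + b * c" using t0 by (simp add: d' t2[symmetric] field_simps power2_eq_square)
    also have "t * w' = b * c * u + d\<^sup>2" using t0 by (simp add: d' t2[symmetric] field_simps power2_eq_square)
    also have "(a\<^sup>2 * u + b * c) * (b * c * u + d\<^sup>2) = A * u\<^sup>2 + B * u + C + u * (x * w)"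
      by (simp add: ABC algebra_simps power2_eq_square)
    finally show ?thesis using u by simp
  qed
  then have xw: "x' * w' = x * w" using u0 by simp
  \<comment> \<open>Both matrices have determinant 1, so the antidiagonal products agree as
    well.\<close>
  have "x' * w' - y' * z' = (a * d - b * c)\<^sup>2"
    using t0 by (simp add: d' field_simps power2_eq_square)
  then have yz: "y' * z' = y * z" using xw D by (simp add: algebra_simps)
  have nz': "x' \<noteq> 0" "w' \<noteq> 0" "y' \<noteq> 0" "z' \<noteq> 0" using xw yz nz by auto
  \<comment> \<open>Solves s s' = x / x' and s / s' = y / y'; the lower entries then agree because
    the products do.\<close>
  define s s' where "s = csqrt (x / x' * (y / y'))" "s' = x / x' / s"
  have ss: "s * s = x / x' * (y / y')" by (metis s_s'_def(1) power2_csqrt power2_eq_square)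
  then have s0: "s \<noteq> 0" using nz nz' by auto
  have s'0: "s' \<noteq> 0" using nz nz' s0 by (simp add: s_s'_def)
  have p: "s * s' = x / x'" using s0 by (simp add: s_s'_def)
  have q: "s / s' = y / y'"
  proof -
    have "s / s' = s * s / (x / x')" using s0 by (simp add: s_s'_def(2))
    then show ?thesis unfolding ss using nz nz' by simp
  qed
  have "dg s ** h ** dg t ** h ** dg s' = m"
  proof -
    have e: "(dg s ** h ** dg t ** h ** dg s')$1$1 = (s * s') * x'"
      "(dg s ** h ** dg t ** h ** dg s')$1$2 = (s / s') * y'"
      "(dg s ** h ** dg t ** h ** dg s')$2$1 = z' / (s / s')"
      "(dg s ** h ** dg t ** h ** dg s')$2$2 = w' / (s * s')"
      by (simp_all add: mult2_nth d' abcd algebra_simps add_divide_distrib)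
    have "z' / (y / y') = z" "w' / (x / x') = w"
      using xw yz nz nz' by (simp_all add: field_simps)
    then show ?thesis using nz' by (simp add: mat2_eq_iff e p q xyzw[symmetric])
  qed
  then show ?thesis using s0 t0 s'0 by metis
qed

lemma to_cplx_nth [simp]: "to_cplx A $ i $ j = of_int (A$i$j)"
  by (simp add: to_cplx_def)

lemma to_cplx_mult: "to_cplx (A ** B) = to_cplx A ** to_cplx B"
  by (simp add: mat2_eq_iff mult2_nth)

lemma to_cplx_mpow: "to_cplx (mpow A n) = mpow (to_cplx A) n"
  by (induction n) (simp_all add: to_cplx_mult, simp add: mat2_eq_iff)

lemma det_to_cplx: "det (to_cplx A) = of_int (det A)"
  by (simp add: det_2)

text \<open>The words g^i h g^j h g^k lie in the group. Their three powers are replaced one after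
  the other by torus elements, and in the eigenbasis \<open>P\<close> of \<open>g\<close> the
  factorization above reaches \<open>m\<close>. Nonvanishing of the entries says that
  \<open>h\<close> and \<open>m\<close> map no fixed point of \<open>g\<close> to a fixed point of
  \<open>g\<close>.\<close>

lemma closure_contains_factorization:
  assumes Q: "Q ** P = mat 1" and P: "P ** Q = mat 1" and G: "to_cplx g = P ** dg l ** Q"
    and l: "l \<noteq> 0" "norm l \<noteq> 1" and p: "\<forall>s\<in>to_cplx ` Gamma (g, h). eval_poly4 p s = 0"
    and h: "h \<in> SL2Z" "\<And>i j. (Q ** to_cplx h ** P)$i$j \<noteq> 0"
    and m: "m \<in> SL2Z" "\<And>i j. (Q ** to_cplx m ** P)$i$j \<noteq> 0"
  shows "eval_poly4 p (to_cplx m) = 0"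
proof -
  define D where "D = (\<lambda>t. P ** dg t ** Q)"
  define H where "H = to_cplx h"
  define G where "G = to_cplx g"
  have gG: "g \<in> Gamma (g, h)" "h \<in> Gamma (g, h)"
    by (auto simp: Gamma_def intro: gen_group.gen_base)
  have pG: "mpow g n \<in> Gamma (g, h)" for n
    by (induction n) (use gG in \<open>auto simp: Gamma_def intro: gen_group.intros\<close>)
  have 1: "eval_poly4 p (mpow G i ** H ** mpow G j ** H ** mpow G k) = 0" for i j k
  proof -
    have "mpow g i ** h ** mpow g j ** h ** mpow g k \<in> Gamma (g, h)"
      using pG gG unfolding Gamma_def by (intro gen_group.gen_mult)
    then have "eval_poly4 p (to_cplx (mpow g i ** h ** mpow g j ** h ** mpow g k)) = 0"
      using p by blast
    then show ?thesis by (simp add: to_cplx_mult to_cplx_mpow G_def H_def)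
  qed
  note tc = torus_in_closure[OF Q P G[folded G_def] l]
  have 2: "eval_poly4 p (D s ** H ** mpow G j ** H ** mpow G k) = 0" if "s \<noteq> 0" for s j k
    using tc[of p "mat 1" "H ** mpow G j ** H ** mpow G k" s] 1 that by (simp add: D_def matrix_mul_assoc)
  have 3: "eval_poly4 p (D s ** H ** D t ** H ** mpow G k) = 0" if "s \<noteq> 0" "t \<noteq> 0" for s t k
    using tc[of p "D s ** H" "H ** mpow G k" t] 2 that by (simp add: D_def matrix_mul_assoc)
  have 4: "eval_poly4 p (D s ** H ** D t ** H ** D s') = 0" if "s \<noteq> 0" "t \<noteq> 0" "s' \<noteq> 0" for s t s'
    using tc[of p "D s ** H ** D t ** H" "mat 1" s'] 3 that by (simp add: D_def matrix_mul_assoc)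
  have dQP: "det Q * det P = 1" using Q by (metis det_I det_mul)
  have dd: "det (Q ** to_cplx A ** P) = 1" if "A \<in> SL2Z" for A
    using that dQP by (simp add: det_mul det_to_cplx SL2Z_def)
  obtain s t s' where st: "s \<noteq> 0" "t \<noteq> 0" "s' \<noteq> 0"
    and e: "Q ** to_cplx m ** P = dg s ** (Q ** H ** P) ** dg t ** (Q ** H ** P) ** dg s'"
    using dg_factorization[OF dd[OF h(1)] h(2) dd[OF m(1)] m(2)] unfolding H_def by blast
  have "to_cplx m = (P ** Q) ** to_cplx m ** (P ** Q)" by (simp add: P)
  also have "\<dots> = P ** (Q ** to_cplx m ** P) ** Q" by (simp add: matrix_mul_assoc)
  also have "\<dots> = D s ** H ** D t ** H ** D s'"
    unfolding e D_def by (simp add: matrix_mul_assoc)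
  finally show ?thesis using 4 st by simp
qed

section \<open>Translations in the closure, and thinness\<close>

definition mk2 :: "'a \<Rightarrow> 'a \<Rightarrow> 'a \<Rightarrow> 'a \<Rightarrow> 'a^2^2" where
  "mk2 a b c d = (\<chi> i j. if i = 1 then if j = 1 then a else b else if j = 1 then c else d)"

lemma mk2_nth [simp]: "mk2 a b c d $1$1 = a" "mk2 a b c d $1$2 = b"
  "mk2 a b c d $2$1 = c" "mk2 a b c d $2$2 = d"
  by (simp_all add: mk2_def)

text \<open>Ping-pong supplies the nonvanishing entries: a fixed point of \<open>g\<close> outside
  the zone of \<open>g\<close> would be moved into it, so both lie in that zone, and
  \<open>h\<close> sends them into its own disjoint zone. A translation by more than the distance of
  the two fixed points maps neither of them to itself or to the other.\<close>

lemma good_pair_closure: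
  assumes gp: "good_pair r g h"
  shows "\<exists>K. \<forall>k>K. to_cplx (mk2 1 k 0 1) \<in> zariski_closure_GL2 (to_cplx ` Gamma (g, h))"
proof -
  define a b c d where abcd: "a = real_of_int (g$1$1)" "b = real_of_int (g$1$2)"
    "c = real_of_int (g$2$1)" "d = real_of_int (g$2$2)"
  have gS: "g \<in> SL2Z" and hS: "h \<in> SL2Z" and r: "r > 0" and c0: "c \<noteq> 0"
    and dis: "zone r g \<inter> zone r h = {}" and tr: "\<bar>a + d\<bar> \<ge> 3"
    using gp by (auto simp: good_pair_def abcd tr2_def)
  have "g$1$1 * g$2$2 - g$1$2 * g$2$1 = 1" using gS by (simp add: SL2Z_iff)
  then have D: "a * d - b * c = 1"
    unfolding abcd by (simp only: of_int_mult[symmetric] of_int_diff[symmetric] of_int_eq_1_iff)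
  \<comment> \<open>\<open>l\<close> and \<open>l'\<close> are the eigenvalues of \<open>g\<close>,
    real because |tr g| >= 3.\<close>
  define l where "l = ((a + d) + sqrt ((a + d)\<^sup>2 - 4)) / 2"
  define l' where "l' = (a + d) - l"
  have "(a + d)\<^sup>2 \<ge> 3\<^sup>2" using tr by (metis abs_le_square_iff abs_numeral)
  then have "(sqrt ((a + d)\<^sup>2 - 4))\<^sup>2 = (a + d)\<^sup>2 - 4" by simp
  then have ll: "l * l' = 1" by (simp add: l_def l'_def field_simps power2_eq_square)
  have l0: "l \<noteq> 0" "l' = 1 / l" using ll by (auto simp: eq_divide_eq mult.commute)
  have lne: "\<bar>l\<bar> \<noteq> 1"
  proof
    assume "\<bar>l\<bar> = 1"
    then have "l = 1 \<or> l = -1" by linarith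
    then have "a + d = 2 \<or> a + d = -2" using l0(2) l'_def by auto
    then show False using tr by auto
  qed
  \<comment> \<open>Solving c z + d = l for each eigenvalue gives the fixed points, with
    eigenvectors (z, 1).\<close>
  define z where "z = (\<lambda>i::2. if i = 1 then (l - d) / c else (l' - d) / c)"
  define L where "L = (\<lambda>i::2. if i = 1 then l else l')"
  have L0: "L i \<noteq> 0" for i using l0 by (simp add: L_def)
  have zc: "c * z i + d = L i" for i using c0 by (simp add: z_def L_def)
  have za: "a * z i + b = L i * z i" for i
  proof -
    have q: "L i * L i = (a + d) * L i - 1" using ll by (auto simp: L_def l'_def algebra_simps)
    have "c * (a * z i + b) = a * (c * z i + d) - (a * d - b * c)" by (simp add: algebra_simps)
    also have "\<dots> = a * L i - 1" by (simp add: zc D)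
    also have "\<dots> = L i * (L i - d)" using q by (simp add: algebra_simps)
    also have "\<dots> = L i * (c * z i)" using zc[of i] by simp
    finally have "c * (a * z i + b) = c * (L i * z i)" by simp
    then show ?thesis using c0 by simp
  qed
  have "l \<noteq> l'"
  proof
    assume "l = l'"
    then have "\<bar>l\<bar> = 1" using ll by (metis abs_1 abs_mult_self_eq real_sqrt_abs2 real_sqrt_one)
    then show False using lne by simp
  qed
  then have z12: "z 1 \<noteq> z 2" using c0 by (simp add: z_def)
  have zg: "z i \<in> zone r g" for i
  proof (rule ccontr)
    assume "z i \<notin> zone r g"
    moreover have "L i * z i / L i = z i" using L0 by simp
    moreover have "L i \<noteq> 0 \<and> L i * z i / L i \<in> zone r g" if "z i \<notin> zone r g"
    proof (rule cyc_maps_into_zone[of g r g 1 "z i"])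
      show "g \<in> cyc g" using cyc_mult[OF gS one_in_cyc] by simp
      show "g \<noteq> mat 1" using c0 by (auto simp: mat2_eq_iff abcd)
    qed (use gp that zc za in \<open>simp_all add: good_pair_def abcd\<close>)
    ultimately show False by metis
  qed
  have zh: "of_int (h$1$1) * z i + of_int (h$1$2) \<noteq> z j * (of_int (h$2$1) * z i + of_int (h$2$2))" for i j
  proof
    define p' q' where pq: "p' = of_int (h$1$1) * z i + of_int (h$1$2)" "q' = of_int (h$2$1) * z i + of_int (h$2$2)"
    have "q' \<noteq> 0 \<and> p' / q' \<in> zone r h"
    proof (rule cyc_maps_into_zone[of h r h 1 "z i"])
      show "h \<in> cyc h" using cyc_mult[OF hS one_in_cyc] by simp
      show "h \<noteq> mat 1" using gp by (auto simp: mat2_eq_iff good_pair_def)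
    qed (use gp zg[of i] dis in \<open>auto simp: good_pair_def pq\<close>)
    moreover assume "of_int (h$1$1) * z i + of_int (h$1$2) = z j * (of_int (h$2$1) * z i + of_int (h$2$2))"
    then have "p' = z j * q'" by (simp add: pq)
    ultimately have "z j \<in> zone r h" by auto
    then show False using zg[of j] dis by auto
  qed
  \<comment> \<open>The columns of \<open>P\<close> are the eigenvectors, and \<open>e\<close> is
    the reciprocal of its determinant, so that \<open>Q\<close> is its inverse.\<close>
  define P where "P = mk2 (complex_of_real (z 1)) (complex_of_real (z 2)) 1 1"
  define e where "e = 1 / complex_of_real (z 1 - z 2)"
  have e0: "e \<noteq> 0" using z12 by (simp add: e_def)
  have ez: "e * complex_of_real (z 1) - e * complex_of_real (z 2) = 1"
    using z12 by (simp add: e_def diff_divide_distrib[symmetric])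
  define Q where "Q = mk2 e (- e * complex_of_real (z 2)) (- e) (e * complex_of_real (z 1))"
  have QP: "Q ** P = mat 1"
    using ez by (simp add: mat2_eq_iff mult2_nth P_def Q_def algebra_simps)
  then have PQ: "P ** Q = mat 1" by (simp add: matrix_left_right_inverse)
  have GP: "to_cplx g ** P = P ** dg l"
  proof -
    have e1: "complex_of_int (g$1$1) = of_real a" "complex_of_int (g$1$2) = of_real b"
      "complex_of_int (g$2$1) = of_real c" "complex_of_int (g$2$2) = of_real d"
      by (simp_all add: abcd)
    have "complex_of_real a * of_real (z i) + of_real b = of_real (L i) * of_real (z i)"
      "complex_of_real c * of_real (z i) + of_real d = of_real (L i)" for i
      by (simp_all only: za zc of_real_mult[symmetric] of_real_add[symmetric])
    from this[of 1] this[of 2] show ?thesis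
      by (simp add: mat2_eq_iff mult2_nth P_def e1 L_def l0(2))
  qed
  have G: "to_cplx g = P ** dg l ** Q"
  proof -
    have "to_cplx g = to_cplx g ** (P ** Q)" by (simp add: PQ)
    also have "\<dots> = P ** dg l ** Q" by (simp add: matrix_mul_assoc GP)
    finally show ?thesis .
  qed
  \<comment> \<open>Up to \<open>e\<close> and a sign the entries of the conjugate are the
    differences in the hypothesis, one for each pair of fixed points.\<close>
  have nz: "(Q ** to_cplx m ** P)$i$j \<noteq> 0"
    if m: "\<And>i j. of_int (m$1$1) * z i + of_int (m$1$2) \<noteq> z j * (of_int (m$2$1) * z i + of_int (m$2$2))" for m i j
  proof -
    have m': "complex_of_int (m$1$1) * of_real (z i) + of_int (m$1$2)
        - of_real (z j) * (of_int (m$2$1) * of_real (z i) + of_int (m$2$2)) \<noteq> 0" for i j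
    proof -
      have "complex_of_real (of_int (m$1$1) * z i + of_int (m$1$2)
          - z j * (of_int (m$2$1) * z i + of_int (m$2$2))) \<noteq> 0"
        unfolding of_real_eq_0_iff using m[of i j] by simp
      then show ?thesis by simp
    qed
    let ?f = "\<lambda>i j. complex_of_int (m$1$1) * of_real (z i) + of_int (m$1$2)
        - of_real (z j) * (of_int (m$2$1) * of_real (z i) + of_int (m$2$2))"
    have "(Q ** to_cplx m ** P)$1$1 = e * ?f 1 2" "(Q ** to_cplx m ** P)$1$2 = e * ?f 2 2"
      "(Q ** to_cplx m ** P)$2$1 = - e * ?f 1 1" "(Q ** to_cplx m ** P)$2$2 = - e * ?f 2 1"
      by (simp_all add: mult2_nth P_def Q_def algebra_simps)
    then have "\<forall>i j. (Q ** to_cplx m ** P)$i$j \<noteq> 0"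
      unfolding forall_2 using m'[of 1 1] m'[of 1 2] m'[of 2 1] m'[of 2 2] e0 by simp
    then show ?thesis by blast
  qed
  have "to_cplx (mk2 1 k 0 1) \<in> zariski_closure_GL2 (to_cplx ` Gamma (g, h))"
    if k: "k > \<lceil>\<bar>z 1 - z 2\<bar>\<rceil>" for k
  proof -
    have k': "real_of_int k > \<bar>z 1 - z 2\<bar>" using k by linarith
    have "eval_poly4 p (to_cplx (mk2 1 k 0 1)) = 0"
      if p: "\<forall>s\<in>to_cplx ` Gamma (g, h). eval_poly4 p s = 0" for p
    proof (rule closure_contains_factorization[OF QP PQ G _ _ p hS nz[OF zh]])
      show "complex_of_real l \<noteq> 0" "norm (complex_of_real l) \<noteq> 1" using l0 lne by auto
      show "mk2 1 k 0 1 \<in> SL2Z" by (simp add: SL2Z_iff)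
      have "z i + k \<noteq> z j" for i j
      proof -
        have "\<forall>i j. z i + k \<noteq> z j" unfolding forall_2 using k' by auto
        then show ?thesis by blast
      qed
      then show "(Q ** to_cplx (mk2 1 k 0 1) ** P) $ i $ j \<noteq> 0" for i j
        by (intro nz) simp
    qed
    then show ?thesis by (simp add: zariski_closure_GL2_def det_2)
  qed
  then show ?thesis by blast
qed

text \<open>Equal cosets of \<open>u k\<close> and \<open>u k'\<close> put the translation by k - k'
  into the group; it fixes infinity, so it is trivial. Hence the infinitely many k > K give
  different cosets.\<close>

lemma good_pair_thin:
  assumes gp: "good_pair r g h"
  shows "thin (Gamma (g, h))"
proof -
  define u where "u = (\<lambda>k::int. mk2 1 k 0 1)"
  define H where "H = {A \<in> GL2Z. to_cplx A \<in> zariski_closure_GL2 (to_cplx ` Gamma (g, h))}"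
  obtain K where K: "\<And>k. k > K \<Longrightarrow> to_cplx (u k) \<in> zariski_closure_GL2 (to_cplx ` Gamma (g, h))"
    using good_pair_closure[OF gp] unfolding u_def by blast
  have "inj_on (\<lambda>k. (\<lambda>x. u k ** x) ` Gamma (g, h)) {K<..}"
  proof (rule inj_onI)
    fix k k' assume "(\<lambda>x. u k ** x) ` Gamma (g, h) = (\<lambda>x. u k' ** x) ` Gamma (g, h)"
    moreover have "mat 1 \<in> Gamma (g, h)" by (simp add: Gamma_def gen_group.gen_one)
    ultimately have "u k ** mat 1 \<in> (\<lambda>x. u k' ** x) ` Gamma (g, h)" by blast
    then obtain x where x: "x \<in> Gamma (g, h)" "u k = u k' ** x" by auto
    then have "u (- k') ** u k = u (- k') ** u k' ** x" by (simp add: matrix_mul_assoc)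
    moreover have "u (- k') ** u k' = mat 1" "u (- k') ** u k = u (k - k')"
      by (simp_all add: u_def mat2_eq_iff mult2_nth)
    ultimately have "x = u (k - k')" by simp
    then have "u (k - k') = mat 1"
      using Gamma_fixing_infinity[OF gp x(1)] by (simp add: u_def)
    then show "k = k'" by (simp add: u_def mat2_eq_iff)
  qed
  then have "infinite ((\<lambda>k. (\<lambda>x. u k ** x) ` Gamma (g, h)) ` {K<..})"
    using finite_imageD infinite_Ioi by blast
  moreover have "u k \<in> H" if "k > K" for k
    using K[OF that] by (simp add: H_def GL2Z_def u_def det_2)
  then have "(\<lambda>k. (\<lambda>x. u k ** x) ` Gamma (g, h)) ` {K<..} \<subseteq> {(\<lambda>x. h' ** x) ` Gamma (g, h) | h'. h' \<in> H}"
    by auto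
  ultimately show ?thesis
    unfolding thin_def Let_def H_def[symmetric] using finite_subset by blast
qed

section \<open>Counting\<close>

text \<open>Balls for the largest entry, comparable with the norm balls up to a factor 2 in the
  radius.\<close>

definition sl2_box :: "nat \<Rightarrow> imat set" where
  "sl2_box N = {g \<in> SL2Z. \<forall>i j. \<bar>g$i$j\<bar> \<le> int N}"

lemma sl2_box_iff: "g \<in> sl2_box N \<longleftrightarrow> g$1$1 * g$2$2 - g$1$2 * g$2$1 = 1 \<and>
    \<bar>g$1$1\<bar> \<le> int N \<and> \<bar>g$1$2\<bar> \<le> int N \<and> \<bar>g$2$1\<bar> \<le> int N \<and> \<bar>g$2$2\<bar> \<le> int N"
  by (auto simp: sl2_box_def SL2Z_iff forall_2)

lemma finite_sl2_box [simp]: "finite (sl2_box N)"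
proof (rule inj_on_finite[where f = "\<lambda>g. (g$1$1, g$1$2, g$2$1, g$2$2)"])
  show "inj_on (\<lambda>g. (g$1$1, g$1$2, g$2$1, g$2$2)) (sl2_box N)"
    by (auto simp: inj_on_def mat2_eq_iff)
  show "(\<lambda>g. (g$1$1, g$1$2, g$2$1, g$2$2)) ` sl2_box N
      \<subseteq> {-int N..int N} \<times> {-int N..int N} \<times> {-int N..int N} \<times> {-int N..int N}"
    by (auto simp: sl2_box_iff)
qed simp

lemma card_le_sum_fibres:
  assumes "finite B" "f ` A \<subseteq> B"
  shows "card A \<le> (\<Sum>b\<in>B. card {a\<in>A. f a = b})"
proof -
  have "A = (\<Union>b\<in>B. {a\<in>A. f a = b})" using assms(2) by auto
  then show ?thesis using card_UN_le[OF assms(1), of "\<lambda>b. {a\<in>A. f a = b}"] by simp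
qed

text \<open>Within one residue class modulo \<open>c\<close> the quotient by |c| determines the
  number.\<close>

lemma card_residue_class:
  fixes S :: "int set"
  assumes S: "S \<subseteq> {-int N..int N}" and c: "c \<noteq> 0" and d: "\<And>x y. x \<in> S \<Longrightarrow> y \<in> S \<Longrightarrow> c dvd x - y"
  shows "real (card S) \<le> 2 * real N / \<bar>of_int c\<bar> + 1"
proof -
  let ?f = "\<lambda>x. (x + int N) div \<bar>c\<bar>"
  have inj: "inj_on ?f S"
  proof (rule inj_onI)
    fix x y assume xy: "x \<in> S" "y \<in> S" and e: "?f x = ?f y"
    have "\<bar>c\<bar> dvd (x + int N) - (y + int N)" using d[OF xy] by simp
    then have "(x + int N) mod \<bar>c\<bar> = (y + int N) mod \<bar>c\<bar>" by (simp only: mod_eq_dvd_iff)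
    then have "x + int N = y + int N" using e by (metis div_mult_mod_eq)
    then show "x = y" by simp
  qed
  have "?f ` S \<subseteq> {0..(2 * int N) div \<bar>c\<bar>}"
  proof clarify
    fix x assume "x \<in> S"
    then have "0 \<le> x + int N" "x + int N \<le> 2 * int N" using S by auto
    then show "?f x \<in> {0..(2 * int N) div \<bar>c\<bar>}"
      using c by (auto simp: pos_imp_zdiv_nonneg_iff intro!: zdiv_mono1)
  qed
  then have "card S \<le> card {0..(2 * int N) div \<bar>c\<bar>}"
    using card_inj_on_le[OF inj] by blast
  also have "int \<dots> = (2 * int N) div \<bar>c\<bar> + 1" using c by (simp add: pos_imp_zdiv_nonneg_iff)
  finally have "int (card S) \<le> (2 * int N) div \<bar>c\<bar> + 1" by simp
  then have "real (card S) \<le> real_of_int ((2 * int N) div \<bar>c\<bar>) + 1" by linarith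
  also have "real_of_int ((2 * int N) div \<bar>c\<bar>) \<le> real_of_int (2 * int N) / real_of_int \<bar>c\<bar>"
    by (rule real_of_int_div4)
  finally show ?thesis by simp
qed

lemma det_one_coprime:
  fixes a b c d :: int
  assumes "a * d - b * c = 1" shows "coprime a c"
proof (rule coprimeI)
  fix x assume "x dvd a" "x dvd c"
  then have "x dvd a * d - b * c" by simp
  then show "is_unit x" using assms by simp
qed

text \<open>Two second columns completing the same first column differ by a multiple of it, so the
  lower right entry is fixed modulo \<open>c\<close>; it determines the upper right one as
  \<open>c\<close> is nonzero.\<close>

lemma card_column_fibre_lower:
  assumes c: "c \<noteq> 0"
  shows "real (card {g\<in>sl2_box N. (g$1$1, g$2$1) = (a, c)}) \<le> 2 * real N / \<bar>of_int c\<bar> + 1"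
proof -
  let ?F = "{g\<in>sl2_box N. (g$1$1, g$2$1) = (a, c)}"
  have "inj_on (\<lambda>g. g$2$2) ?F"
  proof (rule inj_onI)
    fix g h assume gh: "g \<in> ?F" "h \<in> ?F" "g$2$2 = h$2$2"
    then have "a * g$2$2 - g$1$2 * c = 1" "a * g$2$2 - h$1$2 * c = 1" by (auto simp: sl2_box_iff)
    then have "g$1$2 * c = h$1$2 * c" by linarith
    then show "g = h" using gh c by (auto simp: mat2_eq_iff)
  qed
  then have "card ?F = card ((\<lambda>g. g$2$2) ` ?F)" by (simp add: card_image)
  also have "real \<dots> \<le> 2 * real N / \<bar>of_int c\<bar> + 1"
  proof (rule card_residue_class[OF _ c])
    show "(\<lambda>g. g$2$2) ` ?F \<subseteq> {-int N..int N}" by (auto simp: sl2_box_iff)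
    fix x y assume "x \<in> (\<lambda>g. g$2$2) ` ?F" "y \<in> (\<lambda>g. g$2$2) ` ?F"
    then obtain g h where gh: "g \<in> ?F" "h \<in> ?F" "x = g$2$2" "y = h$2$2" by auto
    then have e: "a * x - g$1$2 * c = 1" "a * y - h$1$2 * c = 1" by (auto simp: sl2_box_iff)
    then have "a * (x - y) = c * (g$1$2 - h$1$2)" by (simp add: algebra_simps)
    then have "c dvd a * (x - y)" by simp
    moreover have "coprime c a" using det_one_coprime[OF e(1)] by (simp add: coprime_commute)
    ultimately show "c dvd x - y" by (simp add: coprime_dvd_mult_right_iff)
  qed
  finally show ?thesis .
qed

text \<open>The same argument with the upper right entry, which is fixed modulo
  \<open>a\<close>.\<close>

lemma card_column_fibre_upper:
  assumes a: "a \<noteq> 0"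
  shows "real (card {g\<in>sl2_box N. (g$1$1, g$2$1) = (a, c)}) \<le> 2 * real N / \<bar>of_int a\<bar> + 1"
proof -
  let ?F = "{g\<in>sl2_box N. (g$1$1, g$2$1) = (a, c)}"
  have "inj_on (\<lambda>g. g$1$2) ?F"
  proof (rule inj_onI)
    fix g h assume gh: "g \<in> ?F" "h \<in> ?F" "g$1$2 = h$1$2"
    then have "a * g$2$2 - g$1$2 * c = 1" "a * h$2$2 - g$1$2 * c = 1" by (auto simp: sl2_box_iff)
    then have "a * g$2$2 = a * h$2$2" by linarith
    then show "g = h" using gh a by (auto simp: mat2_eq_iff)
  qed
  then have "card ?F = card ((\<lambda>g. g$1$2) ` ?F)" by (simp add: card_image)
  also have "real \<dots> \<le> 2 * real N / \<bar>of_int a\<bar> + 1"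
  proof (rule card_residue_class[OF _ a])
    show "(\<lambda>g. g$1$2) ` ?F \<subseteq> {-int N..int N}" by (auto simp: sl2_box_iff)
    fix x y assume "x \<in> (\<lambda>g. g$1$2) ` ?F" "y \<in> (\<lambda>g. g$1$2) ` ?F"
    then obtain g h where gh: "g \<in> ?F" "h \<in> ?F" "x = g$1$2" "y = h$1$2" by auto
    then have e: "a * g$2$2 - x * c = 1" "a * h$2$2 - y * c = 1" by (auto simp: sl2_box_iff)
    then have "c * (x - y) = a * (g$2$2 - h$2$2)" by (simp add: algebra_simps)
    then have "a dvd c * (x - y)" by simp
    moreover have "coprime a c" using det_one_coprime[OF e(1)] .
    ultimately show "a dvd x - y" by (simp add: coprime_dvd_mult_right_iff)
  qed
  finally show ?thesis .
qed

section \<open>Matrices with small lower left entry\<close>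

lemma sum_inverse_sqrt: "(\<Sum>k=1..n. 1 / sqrt (real k)) \<le> 2 * sqrt (real n)"
proof (induction n)
  case (Suc n)
  define x y where "x = sqrt (real n)" "y = sqrt (real (Suc n))"
  have y: "y > 0" "y\<^sup>2 = real n + 1" and x: "x\<^sup>2 = real n" by (auto simp: x_y_def)
  \<comment> \<open>With y^2 = x^2 + 1 this gives 1 / y <= 2 (y - x), which telescopes.\<close>
  have "0 \<le> (y - x)\<^sup>2" by simp
  then have "2 * x * y + 1 \<le> 2 * y\<^sup>2" using x y by (simp add: power2_diff algebra_simps)
  then have "2 * x + 1 / y \<le> 2 * y" using y(1) by (simp add: field_simps power2_eq_square)
  then show ?case using Suc by (simp add: x_y_def)
qed simp

lemma sum_inverse_sqrt_int: "(\<Sum>a\<in>{-int n..int n} - {0}. 1 / sqrt \<bar>of_int a\<bar>) \<le> 4 * sqrt (real n)"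
proof -
  have s: "{-int n..int n} - {0} = int ` {1..n} \<union> (\<lambda>k. - int k) ` {1..n}"
  proof (intro equalityI subsetI)
    fix x assume x: "x \<in> {-int n..int n} - {0}"
    then have "x = int (nat x) \<and> nat x \<in> {1..n} \<or> x = - int (nat (- x)) \<and> nat (- x) \<in> {1..n}" by auto
    then show "x \<in> int ` {1..n} \<union> (\<lambda>k. - int k) ` {1..n}" by blast
  qed auto
  have "(\<Sum>a\<in>{-int n..int n} - {0}. 1 / sqrt \<bar>of_int a\<bar>)
      = (\<Sum>a\<in>int ` {1..n}. 1 / sqrt \<bar>of_int a\<bar>) + (\<Sum>a\<in>(\<lambda>k. - int k) ` {1..n}. 1 / sqrt \<bar>of_int a\<bar>)"
    unfolding s by (rule sum.union_disjoint) auto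
  also have "\<dots> = (\<Sum>k=1..n. 1 / sqrt (real k)) + (\<Sum>k=1..n. 1 / sqrt (real k))"
    by (subst (1 2) sum.reindex) (auto simp: inj_on_def)
  finally show ?thesis using sum_inverse_sqrt[of n] by linarith
qed

text \<open>The number of second columns is at most \<open>3 N / max \<bar>a\<bar> \<bar>c\<bar>\<close>; replacing the maximum by the
  geometric mean makes the sum over \<open>a\<close> and \<open>c\<close> factor.\<close>

lemma card_sl2_box_lower_left_small:
  assumes N: "N \<ge> 1" and M: "M \<le> N"
  shows "real (card {g\<in>sl2_box N. \<bar>g$2$1\<bar> \<le> int M}) \<le> 48 * real N * sqrt (real N * real M) + 12 * real N"
proof -
  let ?A = "{g\<in>sl2_box N. \<bar>g$2$1\<bar> \<le> int M}"
  let ?I = "\<lambda>n. {-int n..int n} - {0}"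
  \<comment> \<open>The column bounds need a nonzero entry to divide by. If a or c vanishes, two
    entries are +-1 and one is free, so \<open>A0\<close> and \<open>A1\<close> together have at
    most 8 N + 4 <= 12 N elements.\<close>
  define A0 where "A0 = {g\<in>sl2_box N. g$2$1 = 0}"
  define A1 where "A1 = {g\<in>sl2_box N. g$1$1 = 0}"
  define A2 where "A2 = {g\<in>?A. g$1$1 \<noteq> 0 \<and> g$2$1 \<noteq> 0}"
  have "card A0 \<le> card ({1, -1::int} \<times> {-int N..int N})"
  proof (rule card_inj_on_le[where f = "\<lambda>g. (g$1$1, g$1$2)"])
    have ad: "g$1$1 = 1 \<and> g$2$2 = 1 \<or> g$1$1 = -1 \<and> g$2$2 = -1" if "g \<in> A0" for g
      using that by (auto simp: A0_def sl2_box_iff zmult_eq_1_iff)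
    show "inj_on (\<lambda>g. (g$1$1, g$1$2)) A0"
    proof (rule inj_onI)
      fix g h assume "g \<in> A0" "h \<in> A0" "(g$1$1, g$1$2) = (h$1$1, h$1$2)"
      then show "g = h" using ad[of g] ad[of h] by (auto simp: mat2_eq_iff A0_def)
    qed
    show "(\<lambda>g. (g$1$1, g$1$2)) ` A0 \<subseteq> {1, -1} \<times> {-int N..int N}"
      using ad by (fastforce simp: A0_def sl2_box_iff)
  qed simp
  then have c0: "card A0 \<le> 2 * (2 * N + 1)" by (simp add: card_cartesian_product)
  have "card A1 \<le> card ({1, -1::int} \<times> {-int N..int N})"
  proof (rule card_inj_on_le[where f = "\<lambda>g. (g$1$2, g$2$2)"])
    have ad: "g$1$2 = 1 \<and> g$2$1 = -1 \<or> g$1$2 = -1 \<and> g$2$1 = 1" if "g \<in> A1" for g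
    proof -
      have "g$1$2 * (- (g$2$1)) = 1" using that by (auto simp: A1_def sl2_box_iff)
      then show ?thesis unfolding zmult_eq_1_iff by auto
    qed
    show "inj_on (\<lambda>g. (g$1$2, g$2$2)) A1"
    proof (rule inj_onI)
      fix g h assume "g \<in> A1" "h \<in> A1" "(g$1$2, g$2$2) = (h$1$2, h$2$2)"
      then show "g = h" using ad[of g] ad[of h] by (auto simp: mat2_eq_iff A1_def)
    qed
    show "(\<lambda>g. (g$1$2, g$2$2)) ` A1 \<subseteq> {1, -1} \<times> {-int N..int N}"
      using ad by (fastforce simp: A1_def sl2_box_iff)
  qed simp
  then have c1: "card A1 \<le> 2 * (2 * N + 1)" by (simp add: card_cartesian_product)
  have "real (card A2) \<le> (\<Sum>ac\<in>?I N \<times> ?I M. real (card {g\<in>A2. (g$1$1, g$2$1) = ac}))"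
  proof -
    have "card A2 \<le> (\<Sum>ac\<in>?I N \<times> ?I M. card {g\<in>A2. (g$1$1, g$2$1) = ac})"
      by (rule card_le_sum_fibres) (auto simp: A2_def sl2_box_iff)
    then show ?thesis unfolding of_nat_sum[symmetric] by (rule of_nat_mono)
  qed
  also have "\<dots> \<le> (\<Sum>(a, c)\<in>?I N \<times> ?I M. 3 * real N * (1 / sqrt \<bar>of_int a\<bar> * (1 / sqrt \<bar>of_int c\<bar>)))"
  proof (rule sum_mono)
    fix ac assume "ac \<in> ?I N \<times> ?I M"
    then obtain a c where ac_eq: "ac = (a, c)"
      and ac: "a \<in> {-int N..int N}" "c \<in> {-int M..int M}" "a \<noteq> 0" "c \<noteq> 0" by blast
    define k where "k = real (card {g\<in>A2. (g$1$1, g$2$1) = (a, c)})"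
    define \<alpha> \<gamma> where ag: "\<alpha> = \<bar>real_of_int a\<bar>" "\<gamma> = \<bar>real_of_int c\<bar>"
    have "\<bar>a\<bar> \<le> int N" "\<bar>c\<bar> \<le> int N" "\<bar>a\<bar> \<ge> 1" "\<bar>c\<bar> \<ge> 1" using ac M by auto
    then have pos: "\<alpha> \<ge> 1" "\<gamma> \<ge> 1" "\<alpha> \<le> N" "\<gamma> \<le> N" unfolding ag by linarith+
    have k: "k \<le> real (card {g\<in>sl2_box N. (g$1$1, g$2$1) = (a, c)})"
      unfolding k_def by (intro of_nat_mono card_mono) (auto simp: A2_def)
    have "k \<le> 2 * real N / \<alpha> + 1" using k card_column_fibre_upper[OF ac(3), of N c] by (simp add: ag)
    also have "\<dots> \<le> 3 * real N / \<alpha>" using pos by (simp add: field_simps)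
    finally have k1: "k \<le> 3 * real N / \<alpha>" .
    have "k \<le> 2 * real N / \<gamma> + 1" using k card_column_fibre_lower[OF ac(4), of N a] by (simp add: ag)
    also have "\<dots> \<le> 3 * real N / \<gamma>" using pos by (simp add: field_simps)
    finally have k2: "k \<le> 3 * real N / \<gamma>" .
    have "k * k \<le> (3 * real N / \<alpha>) * (3 * real N / \<gamma>)"
      using k1 k2 pos by (intro mult_mono) (auto simp: k_def)
    then have "k\<^sup>2 \<le> (3 * real N * (1 / sqrt \<alpha> * (1 / sqrt \<gamma>)))\<^sup>2"
      using pos by (simp add: power2_eq_square field_simps)
    then have "k \<le> 3 * real N * (1 / sqrt \<alpha> * (1 / sqrt \<gamma>))"
      by (rule power2_le_imp_le) (use pos in simp)
    then show "real (card {g\<in>A2. (g$1$1, g$2$1) = ac})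
        \<le> (case ac of (a, c) \<Rightarrow> 3 * real N * (1 / sqrt \<bar>of_int a\<bar> * (1 / sqrt \<bar>of_int c\<bar>)))"
      by (simp add: k_def ag ac_eq)
  qed
  also have "\<dots> = 3 * real N * ((\<Sum>a\<in>?I N. 1 / sqrt \<bar>of_int a\<bar>) * (\<Sum>c\<in>?I M. 1 / sqrt \<bar>of_int c\<bar>))"
    by (simp only: sum_product sum.cartesian_product) (simp only: sum_distrib_left split_def)
  also have "\<dots> \<le> 3 * real N * ((4 * sqrt N) * (4 * sqrt M))"
    by (intro mult_left_mono mult_mono sum_inverse_sqrt_int sum_nonneg) auto
  finally have c2: "real (card A2) \<le> 48 * real N * sqrt (real N * real M)"
    by (simp add: real_sqrt_mult)
  have "card ?A \<le> card (A0 \<union> A1 \<union> A2)"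
    by (intro card_mono) (auto simp: A0_def A1_def A2_def)
  also have "\<dots> \<le> card A0 + card A1 + card A2"
    by (meson add_right_mono card_Un_le order_trans)
  finally have "real (card ?A) \<le> real (card A0) + real (card A1) + real (card A2)"
    by linarith
  moreover have "real (card A0 + card A1) \<le> real (12 * N)" using c0 c1 N by (intro of_nat_mono) simp
  then have "real (card A0) + real (card A1) \<le> 12 * real N" by simp
  ultimately show ?thesis using c2 by linarith
qed

text \<open>For M = N the restriction on the lower left entry is void; 60 = 48 + 12.\<close>

lemma card_sl2_box_le: "N \<ge> 1 \<Longrightarrow> real (card (sl2_box N)) \<le> 60 * (real N)\<^sup>2"
proof -
  assume N: "N \<ge> 1"
  have "{g\<in>sl2_box N. \<bar>g$2$1\<bar> \<le> int N} = sl2_box N" by (auto simp: sl2_box_iff)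
  then have "real (card (sl2_box N)) \<le> 48 * real N * sqrt (real N * real N) + 12 * real N"
    using card_sl2_box_lower_left_small[OF N order_refl] by simp
  also have "12 * real N \<le> 12 * (real N)\<^sup>2" using N by (simp add: power2_eq_square)
  finally show ?thesis by (simp add: power2_eq_square)
qed

section \<open>Large divisors and matrices with small trace\<close>

text \<open>Three numbers in an interval of length \<open>M\<close> have pairwise gcds at most \<open>M\<close>,
  so their least common multiple is at least their product divided by \<open>M\<^sup>3\<close>.\<close>

lemma three_close_divisors:
  fixes x y z n M :: nat
  assumes "x dvd n" "y dvd n" "z dvd n" "n > 0" "x < y" "y < z" "z \<le> x + M"
  shows "x * y * z \<le> M ^ 3 * n"
proof -
  have gcd_le: "gcd a b \<le> M" if "a < b" "b \<le> a + M" for a b :: nat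
  proof -
    have "gcd a b dvd b - a" using that by (simp add: dvd_diff_nat)
    then have "gcd a b \<le> b - a" using that by (intro dvd_imp_le) auto
    then show ?thesis using that by linarith
  qed
  define L where "L = lcm x y"
  have "lcm L z dvd n" using assms by (simp add: L_def)
  then have n: "lcm L z \<le> n" using assms by (intro dvd_imp_le)
  have g3: "gcd L z \<le> M * M"
  proof -
    \<comment> \<open>lcm(x, y) divides x y, and gcd(x y, z) divides gcd(x, z) gcd(y, z), where both
      factors are at most M.\<close>
    have "gcd L z dvd gcd (x * y) z" by (intro gcd_mono) (simp_all add: L_def)
    also have "\<dots> dvd gcd x z * gcd y z"
    proof -
      have "gcd x z * gcd y z = gcd (gcd x z * y) (gcd x z * z)" by (simp add: gcd_mult_distrib_nat)
      moreover have "y * gcd x z = gcd (y * x) (y * z)" by (simp add: gcd_mult_distrib_nat)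
      then have "gcd (x * y) z dvd gcd x z * y" by (simp add: mult.commute)
      ultimately show ?thesis by simp
    qed
    finally have "gcd L z \<le> gcd x z * gcd y z" using assms by (intro dvd_imp_le) auto
    also have "\<dots> \<le> M * M" using assms by (intro mult_mono gcd_le) auto
    finally show ?thesis .
  qed
  have "x * y = gcd x y * L" unfolding L_def by (rule prod_gcd_lcm_nat)
  then have "x * y * z = gcd x y * (L * z)" by simp
  also have "L * z = gcd L z * lcm L z" by (rule prod_gcd_lcm_nat)
  also have "gcd x y * \<dots> \<le> M * (M * M * n)"
    using assms by (intro mult_mono g3 n gcd_le) auto
  finally show ?thesis by (simp add: power3_eq_cube mult.assoc)
qed

lemma exists_three:
  fixes S :: "nat set"
  assumes "card S \<ge> 3"
  shows "\<exists>x y z. x \<in> S \<and> y \<in> S \<and> z \<in> S \<and> x < y \<and> y < z"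
proof -
  have S: "finite S" using assms card.infinite by fastforce
  define x where "x = Min S"
  define z where "z = Max S"
  have "S \<noteq> {}" using assms by auto
  then have xz: "x \<in> S" "z \<in> S" using S by (simp_all add: x_def z_def)
  have "\<not> S \<subseteq> {x, z}"
  proof
    assume "S \<subseteq> {x, z}"
    then have "card S \<le> card {x, z}" by (simp add: card_mono)
    moreover have "card {x, z} \<le> 2" by (simp add: card_insert_if)
    ultimately show False using assms by simp
  qed
  then obtain y where y: "y \<in> S" "y \<noteq> x" "y \<noteq> z" by auto
  then have "x \<le> y" "y \<le> z" using S by (simp_all add: x_def z_def)
  then have "x < y" "y < z" using y by auto
  then show ?thesis using xz y by blast
qed

text \<open>The range up to N is cut into blocks of length M. Three divisors above \<delta> N in one
  block would give (\<delta> N)^3 <= M^3 n <= 4 M^3 N^2, which fails for large N. So each of the at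
  most N / M + 1 blocks holds at most two.\<close>

lemma few_large_divisors:
  fixes \<delta> \<epsilon> :: real
  assumes "\<delta> > 0" "\<epsilon> > 0"
  shows "\<exists>N0. \<forall>N\<ge>N0. \<forall>n. 0 < n \<longrightarrow> n \<le> (N + 1)\<^sup>2 \<longrightarrow>
    real (card {k. k dvd n \<and> \<delta> * real N < real k \<and> k \<le> N}) \<le> \<epsilon> * real N"
proof -
  \<comment> \<open>M >= 4 / \<epsilon> gives 2 N / M <= \<epsilon> N / 2; \<open>N2\<close> leaves
    the other half for the extra block, and \<open>N1\<close> excludes three divisors in a
    block.\<close>
  define M where "M = nat \<lceil>4 / \<epsilon>\<rceil>"
  have M1: "real M \<ge> 4 / \<epsilon>" unfolding M_def by (rule real_nat_ceiling_ge)
  moreover have "4 / \<epsilon> > 0" using assms by simp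
  ultimately have "real M > 0" by linarith
  then have M: "real M \<ge> 4 / \<epsilon>" "M \<ge> 1" using M1 by auto
  obtain N1 where N1: "real N1 > 4 * real M ^ 3 / \<delta> ^ 3" using reals_Archimedean2 by blast
  obtain N2 where N2: "real N2 > 4 / \<epsilon>" using reals_Archimedean2 by blast
  have "real (card {k. k dvd n \<and> \<delta> * real N < real k \<and> k \<le> N}) \<le> \<epsilon> * real N"
    if N: "N \<ge> max 1 (max N1 N2)" and n: "0 < n" "n \<le> (N + 1)\<^sup>2" for N n :: nat
  proof -
    define S where "S = {k. k dvd n \<and> \<delta> * real N < real k \<and> k \<le> N}"
    have Sf: "finite S" by (rule finite_subset[of _ "{..N}"]) (auto simp: S_def)
    have N0: "N > 0" using N by simp
    have fib: "card {k\<in>S. k div M = b} \<le> 2" for b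
    proof (rule ccontr)
      assume "\<not> ?thesis"
      then have "card {k\<in>S. k div M = b} \<ge> 3" by simp
      from exists_three[OF this] obtain x y z where
        xyz: "x \<in> S" "y \<in> S" "z \<in> S" "x < y" "y < z" and d: "x div M = b" "z div M = b" by auto
      have "x = b * M + x mod M" "z = b * M + z mod M" using div_mult_mod_eq[of x M] div_mult_mod_eq[of z M] d by auto
      moreover have "z mod M < M" using M(2) by simp
      ultimately have zx: "z \<le> x + M" by linarith
      have "x * y * z \<le> M ^ 3 * n"
        using xyz zx n by (intro three_close_divisors) (auto simp: S_def)
      then have "real x * real y * real z \<le> real M ^ 3 * real n"
        by (metis of_nat_le_iff of_nat_mult of_nat_power)
      moreover have "(\<delta> * N) * (\<delta> * N) * (\<delta> * N) \<le> real x * real y * real z"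
        using xyz assms by (intro mult_mono) (auto simp: S_def less_imp_le)
      moreover have "real n \<le> 4 * real N ^ 2"
      proof -
        have "(N + 1)\<^sup>2 \<le> (2 * N)\<^sup>2" by (rule power_mono) (use N0 in auto)
        then have "n \<le> (2 * N)\<^sup>2" using n(2) by simp
        then have "real n \<le> real ((2 * N)\<^sup>2)" by (rule of_nat_mono)
        then show ?thesis by (simp add: power_mult_distrib)
      qed
      then have "real M ^ 3 * real n \<le> real M ^ 3 * (4 * real N ^ 2)" by (intro mult_left_mono) auto
      ultimately have "\<delta> ^ 3 * real N * real N ^ 2 \<le> 4 * real M ^ 3 * real N ^ 2"
        by (simp add: power3_eq_cube power2_eq_square algebra_simps)
      then have "\<delta> ^ 3 * real N \<le> 4 * real M ^ 3" using N0 by simp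
      moreover have "4 * real M ^ 3 < \<delta> ^ 3 * real N1" using N1 assms by (simp add: field_simps)
      moreover have "\<delta> ^ 3 * real N1 \<le> \<delta> ^ 3 * real N" using N assms by simp
      ultimately show False by linarith
    qed
    have "card S \<le> (\<Sum>b\<in>{0..N div M}. card {k\<in>S. k div M = b})"
      by (rule card_le_sum_fibres) (auto simp: S_def intro: div_le_mono)
    also have "\<dots> \<le> (\<Sum>b\<in>{0..N div M}. 2)" by (intro sum_mono fib)
    finally have "card S \<le> 2 * (N div M) + 2" by simp
    then have "real (card S) \<le> real (2 * (N div M) + 2)" by (rule of_nat_mono)
    then have "real (card S) \<le> 2 * real (N div M) + 2" by simp
    also have "real (N div M) \<le> real N / real M" by (rule of_nat_div_le_of_nat)
    also have "real N / real M \<le> real N / (4 / \<epsilon>)"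
      using M assms by (intro divide_left_mono) auto
    also have "2 * (real N / (4 / \<epsilon>)) + 2 \<le> \<epsilon> * real N"
    proof -
      have "real N > 4 / \<epsilon>" using N N2 by (auto simp: max_def split: if_splits)
      then have "\<epsilon> * real N > 4" using assms by (simp add: field_simps)
      then show ?thesis by simp
    qed
    finally show ?thesis by (simp add: S_def)
  qed
  then show ?thesis by blast
qed

text \<open>For given trace t and upper left entry a, the off-diagonal entries have product a (t -
  a) - 1, so the lower left entry is a large divisor of a number of size at most (N + 1)^2. There
  are only five traces and 2 N + 1 values of a.\<close>

lemma card_small_trace:
  fixes \<delta> \<epsilon> :: real
  assumes "\<delta> > 0" "\<epsilon> > 0"
  shows "\<exists>N0. \<forall>N\<ge>N0. real (card {g\<in>sl2_box N. \<delta> * real N < \<bar>real_of_int (g$2$1)\<bar> \<and> \<bar>tr2 g\<bar> \<le> 2}) \<le> \<epsilon> * (real N)\<^sup>2"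
proof -
  \<comment> \<open>Two signs of the divisor, five traces and at most 3 N values of a turn
    \<epsilon> / 60 into \<epsilon> / 2; the other half pays for the at most 6 N elements of
    \<open>A0\<close>.\<close>
  obtain N0 where N0: "\<And>N n. N \<ge> N0 \<Longrightarrow> 0 < n \<Longrightarrow> n \<le> (N + 1)\<^sup>2 \<Longrightarrow>
      real (card {k. k dvd n \<and> \<delta> * real N < real k \<and> k \<le> N}) \<le> \<epsilon> / 60 * real N"
    using few_large_divisors[of \<delta> "\<epsilon> / 60"] assms by auto
  obtain N1 where N1: "real N1 > 12 / \<epsilon>" using reals_Archimedean2 by blast
  have "real (card {g\<in>sl2_box N. \<delta> * real N < \<bar>real_of_int (g$2$1)\<bar> \<and> \<bar>tr2 g\<bar> \<le> 2}) \<le> \<epsilon> * (real N)\<^sup>2"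
    if N: "N \<ge> max 2 (max N0 N1)" for N
  proof -
    define A where "A = {g\<in>sl2_box N. \<delta> * real N < \<bar>real_of_int (g$2$1)\<bar> \<and> \<bar>tr2 g\<bar> \<le> 2}"
    \<comment> \<open>If the upper right entry vanishes, the number to be divided is 0 and every
      divisor is allowed; but then both diagonal entries are +-1 and only the lower left entry is
      free.\<close>
    define A0 where "A0 = {g\<in>A. g$1$2 = 0}"
    define A1 where "A1 = {g\<in>A. g$1$2 \<noteq> 0}"
    have "card A0 \<le> card ({1, -1::int} \<times> {-int N..int N})"
    proof (rule card_inj_on_le[where f = "\<lambda>g. (g$1$1, g$2$1)"])
      have ad: "g$1$1 = 1 \<and> g$2$2 = 1 \<or> g$1$1 = -1 \<and> g$2$2 = -1" if "g \<in> A0" for g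
        using that by (auto simp: A0_def A_def sl2_box_iff zmult_eq_1_iff)
      show "inj_on (\<lambda>g. (g$1$1, g$2$1)) A0"
      proof (rule inj_onI)
        fix g h assume "g \<in> A0" "h \<in> A0" "(g$1$1, g$2$1) = (h$1$1, h$2$1)"
        then show "g = h" using ad[of g] ad[of h] by (auto simp: mat2_eq_iff A0_def)
      qed
      show "(\<lambda>g. (g$1$1, g$2$1)) ` A0 \<subseteq> {1, -1} \<times> {-int N..int N}"
        using ad by (fastforce simp: A0_def A_def sl2_box_iff)
    qed simp
    then have c0: "card A0 \<le> 2 * (2 * N + 1)" by (simp add: card_cartesian_product)
    let ?B = "{-2..2::int} \<times> {-int N..int N}"
    have "card A1 \<le> (\<Sum>ta\<in>?B. card {g\<in>A1. (tr2 g, g$1$1) = ta})"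
      by (rule card_le_sum_fibres) (auto simp: A1_def A_def sl2_box_iff)
    then have "real (card A1) \<le> (\<Sum>ta\<in>?B. real (card {g\<in>A1. (tr2 g, g$1$1) = ta}))"
      unfolding of_nat_sum[symmetric] by (rule of_nat_mono)
    also have "\<dots> \<le> (\<Sum>ta\<in>?B. \<epsilon> / 30 * real N)"
    proof (rule sum_mono)
      fix ta assume "ta \<in> ?B"
      then obtain t a where ta: "ta = (t, a)" "\<bar>t\<bar> \<le> 2" "\<bar>a\<bar> \<le> int N" by auto
      define F where "F = {g\<in>A1. (tr2 g, g$1$1) = (t, a)}"
      define n where "n = nat \<bar>a * (t - a) - 1\<bar>"
      define D where "D = {k. k dvd n \<and> \<delta> * real N < real k \<and> k \<le> N}"
      have \<delta>N: "\<not> \<delta> * real N < 0" using assms by (simp add: not_less)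
      have Df: "finite D" by (rule finite_subset[of _ "{..N}"]) (auto simp: D_def)
      have F: "a * (t - a) - 1 = g$1$2 * g$2$1" "g$2$1 \<noteq> 0" "g$1$2 \<noteq> 0" "g$1$1 = a" "g$2$2 = t - a"
        if "g \<in> F" for g
        using that \<delta>N by (auto simp: F_def A1_def A_def sl2_box_iff tr2_def algebra_simps)
      have "card F \<le> card ({1, -1::int} \<times> D)"
      proof (rule card_inj_on_le[where f = "\<lambda>g. (sgn (g$2$1), nat \<bar>g$2$1\<bar>)"])
        show "inj_on (\<lambda>g. (sgn (g$2$1), nat \<bar>g$2$1\<bar>)) F"
        proof (rule inj_onI)
          fix g h assume gh: "g \<in> F" "h \<in> F" and e: "(sgn (g$2$1), nat \<bar>g$2$1\<bar>) = (sgn (h$2$1), nat \<bar>h$2$1\<bar>)"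
          then have "\<bar>g$2$1\<bar> = \<bar>h$2$1\<bar>" by auto
          then have c: "g$2$1 = h$2$1" using e by (metis mult_sgn_abs prod.inject)
          then have "g$1$2 * g$2$1 = h$1$2 * g$2$1" using F(1)[OF gh(1)] F(1)[OF gh(2)] by metis
          then have "g$1$2 = h$1$2" using F(2)[OF gh(1)] by simp
          then show "g = h" using c F(4,5)[OF gh(1)] F(4,5)[OF gh(2)] by (simp add: mat2_eq_iff)
        qed
        show "(\<lambda>g. (sgn (g$2$1), nat \<bar>g$2$1\<bar>)) ` F \<subseteq> {1, -1} \<times> D"
        proof (rule image_subsetI)
          fix g assume g: "g \<in> F"
          have "g$2$1 dvd a * (t - a) - 1" using F(1)[OF g] by simp
          then have "nat \<bar>g$2$1\<bar> dvd n" unfolding n_def by (simp add: nat_abs_dvd_iff)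
          moreover have "\<delta> * real N < real (nat \<bar>g$2$1\<bar>)" "nat \<bar>g$2$1\<bar> \<le> N"
            using g by (auto simp: F_def A1_def A_def sl2_box_iff)
          moreover have "sgn (g$2$1) \<in> {1, -1}" using F(2)[OF g] by (auto simp: sgn_if)
          ultimately show "(sgn (g$2$1), nat \<bar>g$2$1\<bar>) \<in> {1, -1} \<times> D" by (simp add: D_def)
        qed
      qed (use Df in simp)
      then have cF: "card F \<le> 2 * card D" by (simp add: card_cartesian_product)
      show "real (card {g\<in>A1. (tr2 g, g$1$1) = ta}) \<le> \<epsilon> / 30 * real N"
      proof (cases "F = {}")
        case True
        then have "{g\<in>A1. (tr2 g, g$1$1) = ta} = {}" unfolding F_def ta(1) .
        then show ?thesis using assms by (simp only: card.empty) simp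
      next
        case False
        then obtain g where "g \<in> F" by auto
        then have "a * (t - a) - 1 \<noteq> 0" using F by simp
        then have n0: "n > 0" by (simp add: n_def)
        have "\<bar>a * (t - a)\<bar> \<le> int N * (int N + 2)"
          unfolding abs_mult using ta by (intro mult_mono) auto
        then have "\<bar>a * (t - a) - 1\<bar> \<le> int N * (int N + 2) + 1" by linarith
        also have "\<dots> = int ((N + 1)\<^sup>2)" by (simp add: power2_eq_square algebra_simps)
        finally have "n \<le> (N + 1)\<^sup>2" unfolding n_def by linarith
        then have "real (card D) \<le> \<epsilon> / 60 * real N" unfolding D_def using N0[of N n] N n0 by auto
        then have "real (card F) \<le> \<epsilon> / 30 * real N" using cF by linarith
        then show ?thesis by (simp add: F_def ta(1))
      qed
    qed
    also have "\<dots> = 5 * (2 * real N + 1) * (\<epsilon> / 30 * real N)" by (simp add: card_cartesian_product)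
    also have "\<dots> \<le> 5 * (3 * real N) * (\<epsilon> / 30 * real N)"
      using N assms by (intro mult_right_mono) auto
    finally have c1: "real (card A1) \<le> \<epsilon> / 2 * (real N)\<^sup>2" by (simp add: power2_eq_square)
    have "real N > 12 / \<epsilon>" using N N1 by (auto simp: max_def split: if_splits)
    then have "6 \<le> \<epsilon> / 2 * real N" using assms by (simp add: field_simps)
    then have "6 * real N \<le> \<epsilon> / 2 * real N * real N" by (rule mult_right_mono) simp
    moreover have "real (card A0) \<le> 6 * real N" using c0 N by auto
    ultimately have c0: "real (card A0) \<le> \<epsilon> / 2 * (real N)\<^sup>2" by (simp add: power2_eq_square)
    have "card A \<le> card A0 + card A1"
    proof -
      have "A = A0 \<union> A1" by (auto simp: A0_def A1_def)
      then show ?thesis using card_Un_le by metis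
    qed
    then show ?thesis using c0 c1 unfolding A_def[symmetric] by linarith
  qed
  then show ?thesis by blast
qed

section \<open>Matrices sending infinity near a given point\<close>

lemma card_int_interval_le:
  fixes x y :: real
  assumes "x \<le> y"
  shows "finite {k::int. x \<le> k \<and> k \<le> y}" "real (card {k::int. x \<le> k \<and> k \<le> y}) \<le> y - x + 1"
proof -
  have e: "{k::int. x \<le> k \<and> k \<le> y} = {\<lceil>x\<rceil>..\<lfloor>y\<rfloor>}" by (auto simp: le_floor_iff ceiling_le_iff)
  show "finite {k::int. x \<le> k \<and> k \<le> y}" unfolding e by simp
  show "real (card {k::int. x \<le> k \<and> k \<le> y}) \<le> y - x + 1"
    unfolding e card_atLeastAtMost_int using assms by linarith
qed

text \<open>The lower left entry c takes at most 2 N + 1 values. As |c| <= N, the upper left entry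
  lies within \<rho> N of c \<theta>, and since |c| > \<delta> N each first column has at most 2 /
  \<delta> + 1 completions.\<close>

lemma card_att_near:
  fixes \<delta> \<rho> \<theta> :: real
  assumes \<delta>: "\<delta> > 0" and \<rho>: "\<rho> > 0" and N: "N \<ge> 1"
  shows "real (card {g\<in>sl2_box N. \<delta> * real N < \<bar>real_of_int (g$2$1)\<bar> \<and> \<bar>att g - \<theta>\<bar> < \<rho>})
    \<le> (2 * real N + 1) * (2 * \<rho> * real N + 1) * (2 / \<delta> + 1)"
proof -
  define A where "A = {g\<in>sl2_box N. \<delta> * real N < \<bar>real_of_int (g$2$1)\<bar> \<and> \<bar>att g - \<theta>\<bar> < \<rho>}"
  define C where "C = {c\<in>{-int N..int N}. \<delta> * real N < \<bar>real_of_int c\<bar>}"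
  define I where "I = (\<lambda>c. {k::int. c * \<theta> - \<rho> * N \<le> real_of_int k \<and> real_of_int k \<le> c * \<theta> + \<rho> * N})"
  have \<delta>N: "\<delta> * real N > 0" using \<delta> N by simp
  have le: "c * \<theta> - \<rho> * N \<le> c * \<theta> + \<rho> * N" for c :: real
  proof -
    have "\<rho> * real N \<ge> 0" using \<rho> by simp
    then show ?thesis by linarith
  qed
  have If: "finite (I c)" for c unfolding I_def by (rule card_int_interval_le(1)[OF le])
  have Ic: "real (card (I c)) \<le> 2 * \<rho> * real N + 1" for c
    using card_int_interval_le(2)[OF le[of c]] unfolding I_def by (simp add: algebra_simps)
  have Cf: "finite C" by (rule finite_subset[of _ "{-int N..int N}"]) (auto simp: C_def)
  have "card C \<le> card {-int N..int N}" by (rule card_mono) (auto simp: C_def)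
  then have Cc: "real (card C) \<le> 2 * real N + 1" by simp
  let ?B = "SIGMA c:C. I (of_int c)"
  have Bf: "finite ?B" using Cf If by blast
  have "real (card ?B) = (\<Sum>c\<in>C. real (card (I (of_int c))))" using Cf If by (simp add: card_SigmaI)
  also have "\<dots> \<le> real (card C) * (2 * \<rho> * real N + 1)"
    using sum_bounded_above[of C "\<lambda>c. real (card (I (of_int c)))", OF Ic] by simp
  also have "\<dots> \<le> (2 * real N + 1) * (2 * \<rho> * real N + 1)"
    using Cc \<rho> by (intro mult_right_mono) auto
  finally have Bc: "real (card ?B) \<le> (2 * real N + 1) * (2 * \<rho> * real N + 1)" .
  have "card A \<le> (\<Sum>b\<in>?B. card {g\<in>A. (g$2$1, g$1$1) = b})"
  proof (rule card_le_sum_fibres[OF Bf], rule image_subsetI)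
    fix g assume g: "g \<in> A"
    define a c where ac: "a = real_of_int (g$1$1)" "c = real_of_int (g$2$1)"
    have c: "\<delta> * real N < \<bar>c\<bar>" "\<bar>a / c - \<theta>\<bar> < \<rho>" "\<bar>g$2$1\<bar> \<le> int N"
      using g by (auto simp: A_def att_def ac sl2_box_iff)
    have c0: "c \<noteq> 0" using c(1) \<delta>N by auto
    have cN: "\<bar>c\<bar> \<le> N" using c(3) unfolding ac by linarith
    have "\<bar>a - c * \<theta>\<bar> = \<bar>c\<bar> * \<bar>a / c - \<theta>\<bar>" using c0 by (simp flip: abs_mult add: algebra_simps)
    also have "\<dots> \<le> real N * \<rho>" using c cN by (intro mult_mono) auto
    finally have "\<bar>a - c * \<theta>\<bar> \<le> \<rho> * real N" by (simp add: mult.commute)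
    then have "g$1$1 \<in> I c" unfolding I_def ac(1)[symmetric] mem_Collect_eq by linarith
    moreover have "g$2$1 \<in> C" using c by (auto simp: C_def ac)
    ultimately show "(g$2$1, g$1$1) \<in> ?B" by (simp add: ac)
  qed
  then have "real (card A) \<le> (\<Sum>b\<in>?B. real (card {g\<in>A. (g$2$1, g$1$1) = b}))"
    unfolding of_nat_sum[symmetric] by (rule of_nat_mono)
  also have "\<dots> \<le> real (card ?B) * (2 / \<delta> + 1)"
  proof (rule sum_bounded_above)
    fix b assume "b \<in> ?B"
    then obtain c a where b: "b = (c, a)" and c: "c \<in> C" by blast
    then have c': "\<delta> * real N < \<bar>real_of_int c\<bar>" by (simp add: C_def)
    then have c0: "c \<noteq> 0" using \<delta>N by auto
    have "card {g\<in>A. (g$2$1, g$1$1) = b} \<le> card {g\<in>sl2_box N. (g$1$1, g$2$1) = (a, c)}"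
      by (rule card_mono) (auto simp: A_def b)
    then have "real (card {g\<in>A. (g$2$1, g$1$1) = b}) \<le> 2 * real N / \<bar>of_int c\<bar> + 1"
      using card_column_fibre_lower[OF c0, of N a] by linarith
    also have "2 * real N / \<bar>of_int c\<bar> \<le> 2 * real N / (\<delta> * real N)"
      using c' \<delta>N by (intro divide_left_mono) auto
    also have "\<dots> = 2 / \<delta>" using N by simp
    finally show "real (card {g\<in>A. (g$2$1, g$1$1) = b}) \<le> 2 / \<delta> + 1" by simp
  qed
  also have "\<dots> \<le> (2 * real N + 1) * (2 * \<rho> * real N + 1) * (2 / \<delta> + 1)"
    using Bc \<delta> by (intro mult_right_mono) auto
  finally show ?thesis unfolding A_def .
qed

section \<open>Lower bound for the number of matrices in a box\<close>

text \<open>Telescoping with 1 / k^2 <= 1 / (k - 1) - 1 / k from k = 3 on. The first term 1/4 is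
  kept exact, because a bound of 1 would not leave a positive proportion of coprime pairs.\<close>

lemma sum_inverse_squares_le: "M \<ge> 2 \<Longrightarrow> (\<Sum>k=2..M. 1 / (real k)\<^sup>2) \<le> 3/4 - 1 / real M"
proof (induction M rule: dec_induct)
  case (step M)
  have "1 / (real (Suc M))\<^sup>2 \<le> 1 / (real M * real (Suc M))"
    using step by (intro divide_left_mono) (auto simp: power2_eq_square)
  also have "\<dots> = 1 / real M - 1 / real (Suc M)" using step by (simp add: field_simps)
  finally show ?case using step by simp
qed simp

text \<open>A pair with gcd k > 1 consists of multiples of k, and at most (M / k)^2 pairs do; summed
  over k this is at most 3/4 of all pairs.\<close>

lemma card_coprime_pairs:
  "real (card {(a, c). a \<in> {1..M} \<and> c \<in> {1..M} \<and> coprime a c}) \<ge> (real M)\<^sup>2 / 4"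
proof (cases "M \<ge> 2")
  case False
  then consider "M = 0" | "M = 1" by linarith
  then show ?thesis
  proof cases
    case 2
    have "{(a, c). a \<in> {1..M} \<and> c \<in> {1..M} \<and> coprime a c} = {(1, 1::nat)}" using 2 by auto
    then show ?thesis using 2 by simp
  qed simp
next
  case True
  let ?C = "{(a, c). a \<in> {1..M} \<and> c \<in> {1..M} \<and> coprime a c}"
  let ?D = "\<lambda>k. (\<lambda>(i, j). (k * i, k * j)) ` ({1..M div k} \<times> {1..M div k})"
  have "{1..M} \<times> {1..M} - ?C \<subseteq> (\<Union>k\<in>{2..M}. ?D k)"
  proof (rule subsetI)
    fix p assume "p \<in> {1..M} \<times> {1..M} - ?C"
    then obtain a c where p: "p = (a, c)" and ac: "a \<in> {1..M}" "c \<in> {1..M}" and n: "\<not> coprime a c"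
      by blast
    define k where "k = gcd a c"
    have "k \<noteq> 1" "k \<noteq> 0" using n ac by (auto simp: k_def coprime_iff_gcd_eq_1)
    moreover have "k \<le> a" using ac by (auto simp: k_def intro!: dvd_imp_le)
    ultimately have k: "k \<in> {2..M}" using ac by auto
    obtain i j where ij: "a = k * i" "c = k * j" unfolding k_def by (meson dvdE gcd_dvd1 gcd_dvd2)
    have "i \<le> M div k" "j \<le> M div k" using ac k unfolding ij by (auto simp: less_eq_div_iff_mult_less_eq mult.commute)
    moreover have "i \<ge> 1" "j \<ge> 1" using ac unfolding ij by (auto simp: Suc_le_eq)
    ultimately have "(a, c) \<in> ?D k" unfolding ij by auto
    then show "p \<in> (\<Union>k\<in>{2..M}. ?D k)" using k p by blast
  qed
  then have "card ({1..M} \<times> {1..M} - ?C) \<le> card (\<Union>k\<in>{2..M}. ?D k)" by (intro card_mono) auto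
  also have "\<dots> \<le> (\<Sum>k\<in>{2..M}. card (?D k))" by (rule card_UN_le) simp
  also have "\<dots> \<le> (\<Sum>k\<in>{2..M}. (M div k)\<^sup>2)"
  proof (rule sum_mono)
    fix k
    have "card (?D k) \<le> card ({1..M div k} \<times> {1..M div k})" by (rule card_image_le) simp
    then show "card (?D k) \<le> (M div k)\<^sup>2" by (simp add: card_cartesian_product power2_eq_square)
  qed
  finally have "real (card ({1..M} \<times> {1..M} - ?C)) \<le> (\<Sum>k\<in>{2..M}. (real (M div k))\<^sup>2)"
    unfolding of_nat_power[symmetric] of_nat_sum[symmetric] by (rule of_nat_mono)
  also have "\<dots> \<le> (\<Sum>k\<in>{2..M}. (real M)\<^sup>2 * (1 / (real k)\<^sup>2))"
  proof (rule sum_mono)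
    fix k
    have "(real (M div k))\<^sup>2 \<le> (real M / real k)\<^sup>2" by (intro power_mono of_nat_div_le_of_nat) simp
    then show "(real (M div k))\<^sup>2 \<le> (real M)\<^sup>2 * (1 / (real k)\<^sup>2)" by (simp add: power_divide)
  qed
  also have "\<dots> = (real M)\<^sup>2 * (\<Sum>k=2..M. 1 / (real k)\<^sup>2)" by (simp only: sum_distrib_left)
  also have "\<dots> \<le> (real M)\<^sup>2 * (3/4)"
  proof (rule mult_left_mono)
    have "1 / real M \<ge> 0" by simp
    then show "(\<Sum>k=2..M. 1 / (real k)\<^sup>2) \<le> 3/4" using sum_inverse_squares_le[OF True] by linarith
  qed simp
  finally have "real (card ({1..M} \<times> {1..M} - ?C)) \<le> (real M)\<^sup>2 * (3/4)" .
  moreover have "card ({1..M} \<times> {1..M} - ?C) = card ({1..M} \<times> {1..M}) - card ?C"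
    by (rule card_Diff_subset) (auto intro: finite_subset[of _ "{1..M} \<times> {1..M}"])
  moreover have "card ?C \<le> card ({1..M} \<times> {1..M})" by (rule card_mono) auto
  ultimately show ?thesis by (simp add: card_cartesian_product power2_eq_square of_nat_diff)
qed

text \<open>Bezout completes every coprime column (a, c) with entries from 1 to M. Subtracting a
  multiple of this column reduces d modulo c, which forces b between -1 and a, so the matrix stays
  in the box.\<close>

lemma card_sl2_box_ge: "real (card (sl2_box M)) \<ge> (real M)\<^sup>2 / 4"
proof -
  let ?C = "{(a, c). a \<in> {1..M} \<and> c \<in> {1..M} \<and> coprime a c}"
  have "?C \<subseteq> (\<lambda>g. (nat (g$1$1), nat (g$2$1))) ` sl2_box M"
  proof (rule subsetI)
    fix p assume "p \<in> ?C"
    then obtain a c where p: "p = (a, c)" and ac: "a \<in> {1..M}" "c \<in> {1..M}" "coprime a c" by blast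
    have "coprime (int a) (int c)" using ac by simp
    then obtain u v where uv: "u * int a + v * int c = 1" using bezout_int[of "int a" "int c"] by auto
    define w where "w = u div int c"
    define d where "d = u mod int c"
    define b where "b = - v - int a * w"
    have d': "d = u - int c * w" by (simp add: d_def w_def minus_mult_div_eq_mod)
    have "int a * d - b * int c = u * int a + v * int c" unfolding b_def d' by (simp add: algebra_simps)
    then have e: "int a * d - b * int c = 1" using uv by simp
    have c0: "int c > 0" using ac by simp
    have d: "0 \<le> d" "d < int c" using c0 by (simp_all add: d_def)
    have ad: "0 \<le> int a * d" "int a * d \<le> int a * int c" using d by (auto intro!: mult_left_mono)
    have "b * int c \<ge> (-1) * int c" using e ad c0 by linarith
    then have b1: "b \<ge> -1" using c0 by (rule mult_right_le_imp_le)
    have "b * int c \<le> int a * int c" using e ad by linarith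
    then have b2: "b \<le> int a" using c0 by (rule mult_right_le_imp_le)
    have "mk2 (int a) b (int c) d \<in> sl2_box M"
      using e d b1 b2 ac by (auto simp: sl2_box_iff)
    moreover have "p = (\<lambda>g. (nat (g$1$1), nat (g$2$1))) (mk2 (int a) b (int c) d)" by (simp add: p)
    ultimately show "p \<in> (\<lambda>g. (nat (g$1$1), nat (g$2$1))) ` sl2_box M" by (rule rev_image_eqI)
  qed
  then have "card ?C \<le> card (sl2_box M)" by (rule surj_card_le[OF finite_sl2_box])
  then show ?thesis using card_coprime_pairs[of M] by linarith
qed

section \<open>Comparison of norm balls with boxes\<close>

text \<open>\<open>T\<close> is the trace of the positive semidefinite matrix g^t g, hence the sum
  of its two eigenvalues, and the larger one lies between T / 2 and T. As \<open>lambda_max\<close>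
  is a supremum, the lower bound needs an explicit eigenvector.\<close>

lemma frobenius_bounds_lambda_max:
  fixes g :: imat
  defines "T \<equiv> (real_of_int (g$1$1))\<^sup>2 + (real_of_int (g$1$2))\<^sup>2 + (real_of_int (g$2$1))\<^sup>2 + (real_of_int (g$2$2))\<^sup>2"
  shows "lambda_max (transpose (to_real g) ** to_real g) \<le> T"
    and "T / 2 \<le> lambda_max (transpose (to_real g) ** to_real g)"
proof -
  define a b c d where abcd: "a = real_of_int (g$1$1)" "b = real_of_int (g$1$2)"
    "c = real_of_int (g$2$1)" "d = real_of_int (g$2$2)"
  define p q s where pqs: "p = a * a + c * c" "q = a * b + c * d" "s = b * b + d * d"
  define M where "M = transpose (to_real g) ** to_real g"
  have T: "T = p + s" by (simp add: T_def pqs abcd power2_eq_square)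
  have M: "M$1$1 = p" "M$1$2 = q" "M$2$1 = q" "M$2$2 = s"
    by (simp_all add: M_def mult2_nth transpose_def to_real_def pqs abcd)
  have ev: "M *v v = l *\<^sub>R v \<longleftrightarrow> p * v$1 + q * v$2 = l * v$1 \<and> q * v$1 + s * v$2 = l * v$2" for v l
    by (simp add: vec_eq_iff forall_2 matrix_vector_mult_def sum_2 M)
  let ?E = "{l. \<exists>v::real^2. v \<noteq> 0 \<and> M *v v = l *\<^sub>R v}"
  have ub: "l \<le> T" if "l \<in> ?E" for l
  proof -
    obtain v :: "real^2" where v: "v \<noteq> 0" "p * v$1 + q * v$2 = l * v$1" "q * v$1 + s * v$2 = l * v$2"
      using \<open>l \<in> ?E\<close> ev by blast
    define x y where xy: "x = v$1" "y = v$2"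
    have "x \<noteq> 0 \<or> y \<noteq> 0" using v(1) by (auto simp: vec_eq_iff forall_2 xy)
    then have pos: "x\<^sup>2 + y\<^sup>2 > 0" by (simp add: sum_power2_gt_zero_iff)
    have "l * (x\<^sup>2 + y\<^sup>2) = x * (l * x) + y * (l * y)" by (simp add: power2_eq_square algebra_simps)
    also have "\<dots> = x * (p * x + q * y) + y * (q * x + s * y)" using v(2,3) by (simp add: xy)
    \<comment> \<open>Lagrange's identity: T |v|^2 - |g v|^2 is a sum of two squares.\<close>
    also have "\<dots> = T * (x\<^sup>2 + y\<^sup>2) - ((a * y - b * x)\<^sup>2 + (c * y - d * x)\<^sup>2)"
      by (simp add: T pqs power2_eq_square algebra_simps)
    also have "\<dots> \<le> T * (x\<^sup>2 + y\<^sup>2)" by simp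
    finally show ?thesis using pos by simp
  qed
  define l where "l = (p + s + sqrt ((p - s)\<^sup>2 + 4 * q\<^sup>2)) / 2"
  have lT: "T / 2 \<le> l" unfolding l_def T by simp
  have "(sqrt ((p - s)\<^sup>2 + 4 * q\<^sup>2))\<^sup>2 = (p - s)\<^sup>2 + 4 * q\<^sup>2" by simp
  moreover have "sqrt ((p - s)\<^sup>2 + 4 * q\<^sup>2) = 2 * l - (p + s)" by (simp add: l_def field_simps)
  ultimately have "(2 * l - (p + s))\<^sup>2 = (p - s)\<^sup>2 + 4 * q\<^sup>2" by simp
  then have lq: "(l - p) * (l - s) = q * q" by (simp add: power2_eq_square algebra_simps)
  have lE: "l \<in> ?E"
  \<comment> \<open>For the larger root \<open>l\<close> of the characteristic polynomial, (q, l -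
    p) is an eigenvector unless it is zero, and then the first basis vector is one.\<close>
  proof (cases "q = 0 \<and> l = p")
    case True
    then have "M *v axis 1 1 = l *\<^sub>R (axis 1 1 :: real^2)" unfolding ev by (simp add: axis_def)
    moreover have "(axis 1 1 :: real^2) \<noteq> 0" by (simp add: axis_eq_0_iff)
    ultimately show ?thesis by blast
  next
    case False
    define v :: "real^2" where "v = (\<chi> i. if i = 1 then q else l - p)"
    have v: "v$1 = q" "v$2 = l - p" by (simp_all add: v_def)
    have "v \<noteq> 0" using False v by (auto simp: vec_eq_iff forall_2)
    moreover have "M *v v = l *\<^sub>R v" unfolding ev v using lq by (simp add: algebra_simps)
    ultimately show ?thesis by blast
  qed
  show "lambda_max (transpose (to_real g) ** to_real g) \<le> T"
    unfolding lambda_max_def M_def[symmetric] using lE ub by (intro cSup_least) auto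
  have "l \<le> Sup ?E" using lE ub by (intro cSup_upper bdd_aboveI) auto
  then show "T / 2 \<le> lambda_max (transpose (to_real g) ** to_real g)"
    unfolding lambda_max_def M_def[symmetric] using lT by linarith
qed

text \<open>Each squared entry is at most T, which is at most twice the largest eigenvalue, hence at
  most 2 X^2 <= (2 X)^2; rounding down is harmless for integers.\<close>

lemma ball_subset_box: "ball_X X \<subseteq> sl2_box (nat \<lfloor>2 * X\<rfloor>)"
proof
  fix g assume g: "g \<in> ball_X X"
  define T where "T = (real_of_int (g$1$1))\<^sup>2 + (real_of_int (g$1$2))\<^sup>2 + (real_of_int (g$2$1))\<^sup>2 + (real_of_int (g$2$2))\<^sup>2"
  define L where "L = lambda_max (transpose (to_real g) ** to_real g)"
  have L: "T / 2 \<le> L" unfolding T_def L_def by (rule frobenius_bounds_lambda_max)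
  have "sqrt L \<le> X" using g by (simp add: ball_X_def mnorm_def L_def)
  then have LX: "L \<le> X\<^sup>2" by (rule sqrt_le_D)
  have "T \<ge> 0" by (simp add: T_def)
  then have "L \<ge> 0" using L by linarith
  then have "0 \<le> sqrt L" by simp
  then have X: "X \<ge> 0" using \<open>sqrt L \<le> X\<close> by linarith
  have T: "T \<le> (2 * X)\<^sup>2" using L LX \<open>T \<ge> 0\<close> by (simp add: power_mult_distrib)
  have e: "\<bar>k\<bar> \<le> int (nat \<lfloor>2 * X\<rfloor>)" if "(real_of_int k)\<^sup>2 \<le> T" for k
  proof -
    have "(real_of_int k)\<^sup>2 \<le> (2 * X)\<^sup>2" using that T by linarith
    then have "\<bar>real_of_int k\<bar> \<le> \<bar>2 * X\<bar>" by (simp only: abs_le_square_iff)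
    then have "\<bar>real_of_int k\<bar> \<le> 2 * X" using X by simp
    then show ?thesis by linarith
  qed
  have "\<forall>i j. (real_of_int (g$i$j))\<^sup>2 \<le> T" unfolding forall_2 T_def by simp
  then have all: "\<forall>i j. \<bar>g$i$j\<bar> \<le> int (nat \<lfloor>2 * X\<rfloor>)" using e by blast
  show "g \<in> sl2_box (nat \<lfloor>2 * X\<rfloor>)"
    using g all unfolding sl2_box_def ball_X_def by blast
qed

text \<open>Four entries of size at most X / 2 give T <= X^2.\<close>

lemma box_subset_ball:
  assumes X: "X \<ge> 0" shows "sl2_box (nat \<lfloor>X / 2\<rfloor>) \<subseteq> ball_X X"
proof
  fix g assume g: "g \<in> sl2_box (nat \<lfloor>X / 2\<rfloor>)"
  have e: "(real_of_int (g$i$j))\<^sup>2 \<le> (X / 2)\<^sup>2" for i j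
  proof -
    have "\<bar>g$i$j\<bar> \<le> int (nat \<lfloor>X / 2\<rfloor>)" using g by (simp add: sl2_box_def)
    then have "\<bar>real_of_int (g$i$j)\<bar> \<le> X / 2" using X by linarith
    then show ?thesis using X by (metis abs_le_square_iff abs_of_nonneg divide_nonneg_nonneg zero_le_numeral)
  qed
  have "lambda_max (transpose (to_real g) ** to_real g) \<le> X\<^sup>2"
    using frobenius_bounds_lambda_max(1)[of g] e[of 1 1] e[of 1 2] e[of 2 1] e[of 2 2]
    by (simp add: power_divide)
  then have "mnorm g \<le> X" unfolding mnorm_def using X by (intro real_le_lsqrt)
  then show "g \<in> ball_X X" using g by (simp add: ball_X_def sl2_box_def)
qed

section \<open>Exceptional matrices and pairs in large boxes\<close>

lemma card_lower_left_small_asymp: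
  fixes \<epsilon> :: real
  assumes \<epsilon>: "\<epsilon> > 0"
  shows "\<exists>\<delta>>0. \<exists>N0. \<forall>N\<ge>N0. real (card {g\<in>sl2_box N. \<bar>real_of_int (g$2$1)\<bar> \<le> \<delta> * real N}) \<le> \<epsilon> * (real N)\<^sup>2"
proof -
  \<comment> \<open>Makes 48 sqrt \<delta> <= \<epsilon> / 2; the cap 1 ensures M <= N, and
    \<open>N1\<close> gives 12 N <= \<epsilon> N^2 / 2.\<close>
  define \<delta> where "\<delta> = min 1 ((\<epsilon> / 96)\<^sup>2)"
  have "sqrt \<delta> \<le> sqrt ((\<epsilon> / 96)\<^sup>2)" unfolding \<delta>_def by (intro real_sqrt_le_mono) simp
  then have \<delta>: "\<delta> > 0" "\<delta> \<le> 1" "sqrt \<delta> \<le> \<epsilon> / 96" using \<epsilon> by (auto simp: \<delta>_def)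
  obtain N1 where N1: "real N1 > 24 / \<epsilon>" using reals_Archimedean2 by blast
  have "real (card {g\<in>sl2_box N. \<bar>real_of_int (g$2$1)\<bar> \<le> \<delta> * real N}) \<le> \<epsilon> * (real N)\<^sup>2"
    if N: "N \<ge> max 1 N1" for N
  proof -
    define M where "M = nat \<lfloor>\<delta> * real N\<rfloor>"
    have \<delta>N: "0 \<le> \<delta> * real N" "\<delta> * real N \<le> real N"
      using \<delta> mult_right_mono[of \<delta> 1 "real N"] by auto
    have MN: "real M \<le> \<delta> * real N" using \<delta>N by (simp add: M_def)
    have "real M \<le> real N" using MN \<delta>N by linarith
    then have "M \<le> N" by simp
    have "{g\<in>sl2_box N. \<bar>real_of_int (g$2$1)\<bar> \<le> \<delta> * real N} \<subseteq> {g\<in>sl2_box N. \<bar>g$2$1\<bar> \<le> int M}"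
      unfolding M_def by auto linarith
    then have "card {g\<in>sl2_box N. \<bar>real_of_int (g$2$1)\<bar> \<le> \<delta> * real N} \<le> card {g\<in>sl2_box N. \<bar>g$2$1\<bar> \<le> int M}"
      by (intro card_mono) auto
    then have "real (card {g\<in>sl2_box N. \<bar>real_of_int (g$2$1)\<bar> \<le> \<delta> * real N})
        \<le> 48 * real N * sqrt (real N * real M) + 12 * real N"
      using card_sl2_box_lower_left_small[of N M] N \<open>M \<le> N\<close> by simp
    also have "sqrt (real N * real M) \<le> sqrt (real N * (\<delta> * real N))"
      using MN by (intro real_sqrt_le_mono mult_left_mono) auto
    also have "\<dots> = sqrt \<delta> * real N" by (simp add: real_sqrt_mult)
    also have "\<dots> \<le> \<epsilon> / 96 * real N" using \<delta> by (intro mult_right_mono) auto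
    also have "48 * real N * (\<epsilon> / 96 * real N) = \<epsilon> / 2 * (real N)\<^sup>2" by (simp add: power2_eq_square)
    also have "12 * real N \<le> \<epsilon> / 2 * (real N)\<^sup>2"
    proof -
      have "real N > 24 / \<epsilon>" using N N1 by (auto simp: max_def split: if_splits)
      then have "12 \<le> \<epsilon> / 2 * real N" using \<epsilon> by (simp add: field_simps)
      then have "12 * real N \<le> \<epsilon> / 2 * real N * real N" by (rule mult_right_mono) simp
      then show ?thesis by (simp add: power2_eq_square)
    qed
    finally show ?thesis by (simp add: mult_left_mono)
  qed
  then show ?thesis using \<delta>(1) by blast
qed

text \<open>The bound is uniform in \<theta> because \<theta> will depend on the other matrix of the
  pair.\<close>

lemma card_att_near_asymp:
  fixes \<delta> \<epsilon> :: real
  assumes \<delta>: "\<delta> > 0" and \<epsilon>: "\<epsilon> > 0"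
  shows "\<exists>\<rho>>0. \<exists>N0. \<forall>N\<ge>N0. \<forall>\<theta>.
    real (card {g\<in>sl2_box N. \<delta> * real N < \<bar>real_of_int (g$2$1)\<bar> \<and> \<bar>att g - \<theta>\<bar> < \<rho>}) \<le> \<epsilon> * (real N)\<^sup>2"
proof -
  define K where "K = 2 / \<delta> + 1"
  have K: "K > 0" using \<delta> by (simp add: K_def add_pos_pos)
  \<comment> \<open>Makes the quadratic term 6 K \<rho> N^2 equal to \<epsilon> N^2 / 2;
    \<open>N1\<close> handles the linear term 3 K N.\<close>
  define \<rho> where "\<rho> = \<epsilon> / (12 * K)"
  have \<rho>: "\<rho> > 0" using \<epsilon> K by (simp add: \<rho>_def)
  obtain N1 where N1: "real N1 > 6 * K / \<epsilon>" using reals_Archimedean2 by blast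
  have "real (card {g\<in>sl2_box N. \<delta> * real N < \<bar>real_of_int (g$2$1)\<bar> \<and> \<bar>att g - \<theta>\<bar> < \<rho>}) \<le> \<epsilon> * (real N)\<^sup>2"
    if N: "N \<ge> max 1 N1" for N \<theta>
  proof -
    have "real (card {g\<in>sl2_box N. \<delta> * real N < \<bar>real_of_int (g$2$1)\<bar> \<and> \<bar>att g - \<theta>\<bar> < \<rho>})
        \<le> (2 * real N + 1) * (2 * \<rho> * real N + 1) * K"
      unfolding K_def using N by (intro card_att_near \<delta> \<rho>) simp
    also have "\<dots> \<le> (3 * real N) * (2 * \<rho> * real N + 1) * K"
      using N \<rho> K by (intro mult_right_mono) auto
    also have "\<dots> = \<epsilon> / 2 * (real N)\<^sup>2 + 3 * K * real N"
      using K by (simp add: \<rho>_def field_simps power2_eq_square)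
    also have "3 * K * real N \<le> \<epsilon> / 2 * (real N)\<^sup>2"
    proof -
      have "real N > 6 * K / \<epsilon>" using N N1 by (auto simp: max_def split: if_splits)
      then have "3 * K \<le> \<epsilon> / 2 * real N" using \<epsilon> by (simp add: field_simps)
      then have "3 * K * real N \<le> \<epsilon> / 2 * real N * real N" by (rule mult_right_mono) simp
      then show ?thesis by (simp add: power2_eq_square)
    qed
    finally show ?thesis by simp
  qed
  then show ?thesis using \<rho> by blast
qed

lemma sl2_inv_in_box [simp]: "sl2_inv g \<in> sl2_box N \<longleftrightarrow> g \<in> sl2_box N"
  by (auto simp: sl2_box_iff algebra_simps)

text \<open>Unless ping-pong applies, a member of the pair has a small lower left entry or a small
  trace, or a centre of one matrix is close to a centre of the other. The first kind contributes 2 *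
  2 * 60 and the four closeness conditions 4 * 60, in total 480.\<close>

lemma card_not_thin:
  fixes \<epsilon> :: real
  assumes \<epsilon>: "\<epsilon> > 0"
  shows "\<exists>N0. \<forall>N\<ge>N0. real (card {p\<in>sl2_box N \<times> sl2_box N. \<not> thin (Gamma p)}) \<le> 480 * \<epsilon> * (real N) ^ 4"
proof -
  obtain \<delta> N1 where \<delta>: "\<delta> > 0" and N1: "\<And>N. N \<ge> N1 \<Longrightarrow>
      real (card {g\<in>sl2_box N. \<bar>real_of_int (g$2$1)\<bar> \<le> \<delta> * real N}) \<le> \<epsilon> * (real N)\<^sup>2"
    using card_lower_left_small_asymp[OF \<epsilon>] by blast
  obtain N2 where N2: "\<And>N. N \<ge> N2 \<Longrightarrow>
      real (card {g\<in>sl2_box N. \<delta> * real N < \<bar>real_of_int (g$2$1)\<bar> \<and> \<bar>tr2 g\<bar> \<le> 2}) \<le> \<epsilon> * (real N)\<^sup>2"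
    using card_small_trace[OF \<delta> \<epsilon>] by blast
  obtain \<rho> N3 where \<rho>: "\<rho> > 0" and N3: "\<And>N \<theta>. N \<ge> N3 \<Longrightarrow>
      real (card {g\<in>sl2_box N. \<delta> * real N < \<bar>real_of_int (g$2$1)\<bar> \<and> \<bar>att g - \<theta>\<bar> < \<rho>}) \<le> \<epsilon> * (real N)\<^sup>2"
    using card_att_near_asymp[OF \<delta> \<epsilon>] by blast
  \<comment> \<open>Open intervals of radius r around centres at distance at least 2 r = \<rho> are
    disjoint; \<open>N4\<close> then makes |c| r >= 2.\<close>
  define r where "r = \<rho> / 2"
  obtain N4 where N4: "real N4 > 2 / (\<delta> * r)" using reals_Archimedean2 by blast
  have "real (card {p\<in>sl2_box N \<times> sl2_box N. \<not> thin (Gamma p)}) \<le> 480 * \<epsilon> * (real N) ^ 4"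
    if N: "N \<ge> Max {1, N1, N2, N3, N4}" for N
  proof -
    have N': "N \<ge> 1" "N \<ge> N1" "N \<ge> N2" "N \<ge> N3" "N \<ge> N4" using N by auto
    define Bx where "Bx = sl2_box N"
    define S where "S = {g\<in>Bx. \<bar>real_of_int (g$2$1)\<bar> \<le> \<delta> * real N} \<union>
      {g\<in>Bx. \<delta> * real N < \<bar>real_of_int (g$2$1)\<bar> \<and> \<bar>tr2 g\<bar> \<le> 2}"
    define near where "near = (\<lambda>\<theta>. {g\<in>Bx. \<delta> * real N < \<bar>real_of_int (g$2$1)\<bar> \<and> \<bar>att g - \<theta>\<bar> < \<rho>})"
    have Bf: "finite Bx" by (simp add: Bx_def)
    have Bc: "real (card Bx) \<le> 60 * (real N)\<^sup>2" unfolding Bx_def by (rule card_sl2_box_le[OF N'(1)])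
    have Sc: "real (card S) \<le> 2 * \<epsilon> * (real N)\<^sup>2"
    proof -
      have "real (card S) \<le> real (card {g\<in>Bx. \<bar>real_of_int (g$2$1)\<bar> \<le> \<delta> * real N})
          + real (card {g\<in>Bx. \<delta> * real N < \<bar>real_of_int (g$2$1)\<bar> \<and> \<bar>tr2 g\<bar> \<le> 2})"
        unfolding S_def of_nat_add[symmetric] by (intro of_nat_mono card_Un_le)
      then show ?thesis using N1[OF N'(2)] N2[OF N'(3)] unfolding Bx_def by linarith
    qed
    \<comment> \<open>\<open>i\<close> and \<open>j\<close> will be the identity or inversion, so
      that four such sets compare both centres of \<open>g\<close> with both of
      \<open>h\<close>.\<close>
    define P where "P = (\<lambda>i j. {(g, h). h \<in> Bx \<and> i g \<in> near (att (j h))} :: (imat \<times> imat) set)"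
    have Pc: "finite (P i j) \<and> real (card (P i j)) \<le> 60 * \<epsilon> * (real N) ^ 4"
      if i: "i = (\<lambda>x. x) \<or> i = sl2_inv" for i j
    proof -
      have inv: "i (i g) = g" for g using i by auto
      have inj: "inj_on i A" for A using inv by (metis inj_on_inverseI)
      \<comment> \<open>Fibred over \<open>h\<close>, which fixes the centre; the involution
        \<open>i\<close> preserves the number of matrices near it.\<close>
      define Q where "Q = (SIGMA h:Bx. i ` near (att (j h)))"
      have nf: "finite (near \<theta>)" for \<theta> using Bf by (simp add: near_def)
      have "P i j = prod.swap ` Q"
      proof (intro equalityI subsetI)
        fix p assume "p \<in> P i j"
        then obtain g h where p: "p = (g, h)" "h \<in> Bx" "i g \<in> near (att (j h))" by (auto simp: P_def)
        then have "(h, i (i g)) \<in> Q" by (simp add: Q_def)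
        then show "p \<in> prod.swap ` Q" using p inv by (metis image_eqI swap_simp)
      qed (auto simp: P_def Q_def inv)
      moreover have "finite Q" using Bf nf by (auto simp: Q_def)
      moreover have "card (prod.swap ` Q) = card Q" by (simp add: card_image)
      moreover have "real (card Q) = (\<Sum>h\<in>Bx. real (card (near (att (j h)))))"
        using Bf nf inj by (simp add: Q_def card_SigmaI card_image)
      moreover have "\<dots> \<le> (\<Sum>h\<in>Bx. \<epsilon> * (real N)\<^sup>2)"
        unfolding near_def Bx_def by (intro sum_mono N3[OF N'(4)])
      moreover have "\<dots> \<le> 60 * (real N)\<^sup>2 * (\<epsilon> * (real N)\<^sup>2)"
        using mult_right_mono[OF Bc, of "\<epsilon> * (real N)\<^sup>2"] \<epsilon> by simp
      ultimately show ?thesis by (simp add: power2_eq_square power4_eq_xxxx mult_ac)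
    qed
    let ?bad = "{p\<in>Bx \<times> Bx. \<not> thin (Gamma p)}"
    let ?id = "\<lambda>x::imat. x"
    have sub: "?bad \<subseteq> S \<times> Bx \<union> Bx \<times> S \<union> (P ?id ?id \<union> P ?id sl2_inv) \<union> (P sl2_inv ?id \<union> P sl2_inv sl2_inv)"
    proof (rule subsetI, rule ccontr)
      fix p assume p: "p \<in> ?bad" and "p \<notin> S \<times> Bx \<union> Bx \<times> S \<union> (P ?id ?id \<union> P ?id sl2_inv) \<union> (P sl2_inv ?id \<union> P sl2_inv sl2_inv)"
      moreover obtain g h where gh: "p = (g, h)" by (cases p)
      ultimately have nP: "g \<notin> near (att h)" "g \<notin> near (att (sl2_inv h))"
        "sl2_inv g \<notin> near (att h)" "sl2_inv g \<notin> near (att (sl2_inv h))"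
        and B: "g \<in> Bx" "h \<in> Bx" and nS: "g \<notin> S" "h \<notin> S" by (auto simp: P_def)
      have c: "\<delta> * real N < \<bar>real_of_int (g$2$1)\<bar>" "\<bar>tr2 g\<bar> \<ge> 3"
        "\<delta> * real N < \<bar>real_of_int (h$2$1)\<bar>" "\<bar>tr2 h\<bar> \<ge> 3"
        using nS B by (auto simp: S_def)
      have nearD: "\<rho> \<le> \<bar>att x - \<theta>\<bar>"
        if "x \<notin> near \<theta>" "x \<in> Bx" "\<delta> * real N < \<bar>real_of_int (x$2$1)\<bar>" for x \<theta>
        using that by (simp add: near_def not_less)
      have inv: "sl2_inv g \<in> Bx" "\<delta> * real N < \<bar>real_of_int (sl2_inv g$2$1)\<bar>"
        using B c by (simp_all add: Bx_def)
      note far = nearD[OF nP(1) B(1) c(1)] nearD[OF nP(2) B(1) c(1)]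
        nearD[OF nP(3) inv] nearD[OF nP(4) inv]
      have r0: "r > 0" using \<rho> by (simp add: r_def)
      have "zone r g \<inter> zone r h = {}"
      proof -
        have "False" if "\<bar>z - x\<bar> < r" "\<bar>z - y\<bar> < r" "\<bar>x - y\<bar> \<ge> \<rho>" for x y z :: real
          using that unfolding r_def by linarith
        then show ?thesis using far unfolding zone_def by blast
      qed
      moreover have "2 \<le> \<bar>x\<bar> * r" if "\<delta> * real N < \<bar>x\<bar>" for x :: real
      proof -
        have "2 / (\<delta> * r) < real N" using N4 N'(5) by (meson less_le_trans of_nat_le_iff)
        then have "2 \<le> (\<delta> * real N) * r" using \<delta> r0 by (simp add: field_simps)
        also have "\<dots> \<le> \<bar>x\<bar> * r" using that r0 by (intro mult_right_mono) auto
        finally show ?thesis .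
      qed
      ultimately have "good_pair r g h"
        using r0 B c by (simp add: good_pair_def Bx_def sl2_box_def)
      then have "thin (Gamma (g, h))" by (rule good_pair_thin)
      then show False using p gh by simp
    qed
    have SBf: "finite S" using Bf by (auto simp: S_def)
    have "card ?bad \<le> card (S \<times> Bx \<union> Bx \<times> S \<union> (P ?id ?id \<union> P ?id sl2_inv) \<union> (P sl2_inv ?id \<union> P sl2_inv sl2_inv))"
      by (rule card_mono[OF _ sub]) (use Pc SBf Bf in auto)
    also have "\<dots> \<le> card (S \<times> Bx) + card (Bx \<times> S) + (card (P ?id ?id) + card (P ?id sl2_inv))
        + (card (P sl2_inv ?id) + card (P sl2_inv sl2_inv))"
      by (intro order_trans[OF card_Un_le] add_mono card_Un_le)
    finally have "real (card ?bad) \<le> 2 * (real (card S) * real (card Bx)) + (real (card (P ?id ?id)) + real (card (P ?id sl2_inv)))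
        + (real (card (P sl2_inv ?id)) + real (card (P sl2_inv sl2_inv)))"
      unfolding card_cartesian_product by (simp flip: of_nat_mult of_nat_add add: mult.commute)
    moreover have "real (card S) * real (card Bx) \<le> (2 * \<epsilon> * (real N)\<^sup>2) * (60 * (real N)\<^sup>2)"
      using Sc Bc \<epsilon> by (intro mult_mono) auto
    then have "real (card S) * real (card Bx) \<le> 120 * \<epsilon> * (real N) ^ 4"
      by (simp add: power2_eq_square power4_eq_xxxx mult_ac)
    moreover have "real (card (P ?id j)) \<le> 60 * \<epsilon> * (real N) ^ 4" "real (card (P sl2_inv j)) \<le> 60 * \<epsilon> * (real N) ^ 4" for j
      using Pc by blast+
    from this[of ?id] this[of sl2_inv] have "real (card (P ?id ?id)) \<le> 60 * \<epsilon> * (real N) ^ 4"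
      "real (card (P ?id sl2_inv)) \<le> 60 * \<epsilon> * (real N) ^ 4" "real (card (P sl2_inv ?id)) \<le> 60 * \<epsilon> * (real N) ^ 4"
      "real (card (P sl2_inv sl2_inv)) \<le> 60 * \<epsilon> * (real N) ^ 4" by blast+
    ultimately show ?thesis unfolding Bx_def[symmetric] by linarith
  qed
  then show ?thesis by blast
qed

section \<open>Passage to norm balls and the limit\<close>

theorem theorem2p1:
  shows "(mu_thin \<longlongrightarrow> 1) at_top"
proof (rule tendstoI)
  fix e :: real assume e: "e > 0"
  \<comment> \<open>480 comes from the count of bad pairs, 16 = 2^4 from the box of size 2 X
    containing the ball, 4096 = 64^2 from the lower bound X^2 / 64 for the ball, and 2 makes the
    final inequality strict.\<close>
  define \<epsilon> where "\<epsilon> = e / (2 * 480 * 16 * 4096)"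
  have \<epsilon>: "\<epsilon> > 0" using e by (simp add: \<epsilon>_def)
  obtain N0 where N0: "\<And>N. N \<ge> N0 \<Longrightarrow>
      real (card {p\<in>sl2_box N \<times> sl2_box N. \<not> thin (Gamma p)}) \<le> 480 * \<epsilon> * (real N) ^ 4"
    using card_not_thin[OF \<epsilon>] by blast
  have "dist (mu_thin X) 1 < e" if X: "X \<ge> max 4 (real N0)" for X
  proof -
    define B where "B = ball_X X"
    define N M where NM: "N = nat \<lfloor>2 * X\<rfloor>" "M = nat \<lfloor>X / 2\<rfloor>"
    have BN: "B \<subseteq> sl2_box N" "sl2_box M \<subseteq> B"
      using ball_subset_box box_subset_ball[of X] X by (auto simp: B_def NM)
    have Bf: "finite B" by (rule finite_subset[OF BN(1)]) simp
    have N: "real N \<le> 2 * X" "N \<ge> N0" using X unfolding NM by linarith+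
    \<comment> \<open>X >= 4 gives X / 2 - 1 >= X / 4, which absorbs the rounding.\<close>
    have M: "real M \<ge> X / 4" using X unfolding NM by linarith
    have "X\<^sup>2 / 64 = (X / 4)\<^sup>2 / 4" by (simp add: power_divide)
    also have "\<dots> \<le> (real M)\<^sup>2 / 4" using M X by (intro divide_right_mono power_mono) auto
    also have "\<dots> \<le> real (card (sl2_box M))" by (rule card_sl2_box_ge)
    also have "\<dots> \<le> real (card B)" by (intro of_nat_mono card_mono Bf BN)
    finally have Bc: "X\<^sup>2 / 64 \<le> real (card B)" .
    define t n where tn: "t = card {p\<in>B \<times> B. thin (Gamma p)}" "n = card {p\<in>B \<times> B. \<not> thin (Gamma p)}"
    have "card (B \<times> B) = t + n"
    proof -
      have "B \<times> B = {p\<in>B \<times> B. thin (Gamma p)} \<union> {p\<in>B \<times> B. \<not> thin (Gamma p)}" by blast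
      then show ?thesis unfolding tn
        using card_Un_disjoint[of "{p\<in>B \<times> B. thin (Gamma p)}" "{p\<in>B \<times> B. \<not> thin (Gamma p)}"] Bf by auto
    qed
    then have tot: "real (card (B \<times> B)) = real t + real n" by simp
    have "(X\<^sup>2 / 64) * (X\<^sup>2 / 64) \<le> real (card B) * real (card B)" using Bc by (intro mult_mono) auto
    then have tn4: "X ^ 4 / 4096 \<le> real t + real n"
      using tot by (simp add: card_cartesian_product power4_eq_xxxx power2_eq_square)
    have X4: "X ^ 4 > 0" using X by simp
    have "n \<le> card {p\<in>sl2_box N \<times> sl2_box N. \<not> thin (Gamma p)}"
      unfolding tn using BN by (intro card_mono) auto
    then have "real n \<le> 480 * \<epsilon> * (real N) ^ 4" using N0[OF N(2)] by linarith
    also have "\<dots> \<le> 480 * \<epsilon> * (2 * X) ^ 4"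
      using N(1) \<epsilon> by (intro mult_left_mono power_mono) auto
    also have "\<dots> = e / 2 * (X ^ 4 / 4096)" by (simp add: \<epsilon>_def power_mult_distrib)
    also have "\<dots> \<le> e / 2 * (real t + real n)" using tn4 e by (intro mult_left_mono) auto
    finally have n: "real n \<le> e / 2 * (real t + real n)" .
    have pos: "real t + real n > 0" using tn4 X4 by linarith
    have "1 - mu_thin X = real n / (real t + real n)"
      using pos by (simp add: mu_thin_def B_def[symmetric] tn(1)[symmetric] tot field_simps del: card_cartesian_product)
    then have "\<bar>1 - mu_thin X\<bar> = real n / (real t + real n)" by simp
    also have "\<dots> \<le> e / 2" using n pos by (simp add: divide_le_eq)
    finally show ?thesis using e by (simp add: dist_real_def abs_minus_commute)
  qed
  then show "\<forall>\<^sub>F X in at_top. dist (mu_thin X) 1 < e"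
    unfolding eventually_at_top_linorder by blast
qed

end
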